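(* Let $(a_j)_{j\ge1}$ be a sequence of nonnegative integers and suppose there are constants $r>0$, $y\ge1$ and $D_1,D_2>0$ such that $D_1 j^{r-1}y^j\le a_j\le D_2 j^{r-1}y^j$ for all $j\ge1$. Define $c_n$ by $\sum_{n\ge0}c_nx^n=\prod_{j\ge1}(1-x^j)^{-a_j}$ for $|x|<1$. For each $n\ge1$ let $\sigma_n>0$ be the unique positive solution of $\sum_{j=1}^n \frac{j a_j e^{-j\sigma}}{1-e^{-j\sigma}}=n$, and let $B_n^2=\sum_{j=1}^n \frac{j^2a_je^{-j\sigma_n}}{(1-e^{-j\sigma_n})^2}$. Then, as $n\to\infty$, $$c_n\sim \frac{e^{n\sigma_n}}{\sqrt{2\pi B_n^2}}\prod_{j=1}^n\left(1-e^{-j\sigma_n}\right)^{-a_j}.$$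
   Context: $c_n$ is the number of multisets of total size $n$ built from components of which there are exactly $a_j$ types of size $j$. The notation $u_n\sim v_n$ means $u_n/v_n\to1$. *)

theory Defs
  imports "HOL-Analysis.Analysis" "HOL-Library.Landau_Symbols"
begin

text \<open>
  The generating function is an infinite product in the metric topology of formal power series.
  As an analytic identity it holds on the disc of convergence only, which shrinks to
  \<open>\<bar>x\<bar> < 1 / y\<close> when the \<open>a j\<close> grow like \<open>y ^ j\<close>; the formal identity
  determines the coefficients in all cases.  \<open>a 0\<close> is never used.
\<close>

definition multiset_gf :: "(nat \<Rightarrow> nat) \<Rightarrow> real fps" where
  "multiset_gf a = (\<Prod>j. inverse (1 - fps_X ^ Suc j) ^ a (Suc j))"

definition multiset_count :: "(nat \<Rightarrow> nat) \<Rightarrow> nat \<Rightarrow> real" where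
  "multiset_count a n = fps_nth (multiset_gf a) n"

definition saddle_sum :: "(nat \<Rightarrow> nat) \<Rightarrow> nat \<Rightarrow> real \<Rightarrow> real" where
  "saddle_sum a n s =
     (\<Sum>j=1..n. real j * real (a j) * exp (- (real j * s)) / (1 - exp (- (real j * s))))"

definition saddle_point :: "(nat \<Rightarrow> nat) \<Rightarrow> nat \<Rightarrow> real" where
  "saddle_point a n = (THE s. s > 0 \<and> saddle_sum a n s = real n)"

definition saddle_var :: "(nat \<Rightarrow> nat) \<Rightarrow> nat \<Rightarrow> real" where
  "saddle_var a n =
     (\<Sum>j=1..n. (real j)\<^sup>2 * real (a j) * exp (- (real j * saddle_point a n))
        / (1 - exp (- (real j * saddle_point a n)))\<^sup>2)"

text \<open>The infinite product and the definite description above are well defined.\<close>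

lemma multiset_gf_has_prod:
  "(\<lambda>j. inverse (1 - fps_X ^ Suc j) ^ a (Suc j)) has_prod multiset_gf a"
proof -
  define f :: "nat \<Rightarrow> real fps" where "f = (\<lambda>j. inverse (1 - fps_X ^ Suc j) ^ a (Suc j))"
  have nth0: "fps_nth (f j) 0 = 1" for j
    by (simp add: f_def fps_nth_power_0)
  have low: "\<exists>g. f j = 1 + fps_X ^ Suc j * g" for j
  proof -
    define u :: "real fps" where "u = inverse (1 - fps_X ^ Suc j)"
    have u: "u = 1 + fps_X ^ Suc j * u"
    proof -
      have "(1 - fps_X ^ Suc j) * u = 1"
        unfolding u_def by (rule inverse_mult_eq_1') simp
      thus ?thesis by (simp add: algebra_simps)
    qed
    have "\<exists>g. u ^ m = 1 + fps_X ^ Suc j * g" for m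
    proof (induction m)
      case 0
      show ?case by (rule exI[of _ 0]) simp
    next
      case (Suc m)
      then obtain g where g: "u ^ m = 1 + fps_X ^ Suc j * g" by blast
      have "u ^ Suc m = u * u ^ m" by simp
      also have "\<dots> = (1 + fps_X ^ Suc j * u) * (1 + fps_X ^ Suc j * g)"
        by (rule arg_cong2[OF u g])
      also have "\<dots> = 1 + fps_X ^ Suc j * (u + g + fps_X ^ Suc j * u * g)"
        by (simp add: algebra_simps)
      finally show ?case by blast
    qed
    thus ?thesis unfolding f_def u_def by blast
  qed
  define P where "P = (\<lambda>n. \<Prod>j\<le>n. f j)"
  have step: "fps_nth (P (Suc n)) k = fps_nth (P n) k" if "k \<le> n" for n k
  proof -
    obtain g where g: "f (Suc n) = 1 + fps_X ^ Suc (Suc n) * g" using low by blast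
    have "P (Suc n) = P n + fps_X ^ Suc (Suc n) * (g * P n)"
      by (simp add: P_def g algebra_simps)
    moreover have "fps_nth (fps_X ^ Suc (Suc n) * (g * P n)) k = 0"
      using that by (subst fps_X_power_mult_nth) simp
    ultimately show ?thesis by simp
  qed
  have stab: "fps_nth (P n) k = fps_nth (P k) k" if "k \<le> n" for n k
    using that by (induction n rule: dec_induct) (auto simp: step)
  define F where "F = Abs_fps (\<lambda>k. fps_nth (P k) k)"
  have lim: "P \<longlonglongrightarrow> F"
  proof (rule tendsto_fpsI)
    fix k
    show "\<forall>\<^sub>F n in sequentially. fps_nth (P n) k = fps_nth F k"
      using eventually_ge_at_top[of k]
    proof eventually_elim
      case (elim n)
      from stab[OF elim] show ?case by (simp only: F_def fps_nth_Abs_fps)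
    qed
  qed
  have "fps_nth F 0 = 1" by (simp add: F_def P_def nth0)
  hence "F \<noteq> 0" by auto
  hence "f has_prod F"
    using lim by (simp add: has_prod_def raw_has_prod_def P_def)
  moreover from this have "multiset_gf a = F"
    unfolding multiset_gf_def f_def by (metis has_prod_unique)
  ultimately show ?thesis by (simp add: f_def)
qed

lemma saddle_point_ex1:
  assumes "n \<ge> 1" and "a 1 \<ge> 1"
  shows "\<exists>!s. s > 0 \<and> saddle_sum a n s = real n"
proof -
  let ?t = "\<lambda>j s. real j * real (a j) * exp (- (real j * s)) / (1 - exp (- (real j * s)))"
  have t: "?t j s = real j * real (a j) / (exp (real j * s) - 1)" if "j \<ge> 1" "s > 0" for j s
  proof -
    have "exp (real j * s) > 1" using that by simp
    thus ?thesis by (simp add: exp_minus field_simps)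
  qed
  have S: "saddle_sum a n s = (\<Sum>j=1..n. real j * real (a j) / (exp (real j * s) - 1))"
    if "s > 0" for s
    unfolding saddle_sum_def using t that by (intro sum.cong) auto
  have less: "saddle_sum a n s' < saddle_sum a n s" if "0 < s" "s < s'" for s s'
  proof -
    have pos: "exp (real j * s') > exp (real j * s)" "exp (real j * s) > 1" if "j \<in> {1..n}" for j
      using that \<open>0 < s\<close> \<open>s < s'\<close> by auto
    have "(\<Sum>j=1..n. real j * real (a j) / (exp (real j * s') - 1))
        < (\<Sum>j=1..n. real j * real (a j) / (exp (real j * s) - 1))"
    proof (rule sum_strict_mono_ex1)
      show "\<forall>j\<in>{1..n}. real j * real (a j) / (exp (real j * s') - 1)
              \<le> real j * real (a j) / (exp (real j * s) - 1)"
      proof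
        fix j assume "j \<in> {1..n}"
        from pos[OF this] show "real j * real (a j) / (exp (real j * s') - 1)
              \<le> real j * real (a j) / (exp (real j * s) - 1)"
          by (intro divide_left_mono mult_pos_pos) auto
      qed
      have "real 1 * real (a 1) / (exp (real 1 * s') - 1)
              < real 1 * real (a 1) / (exp (real 1 * s) - 1)"
        using pos[of 1] assms by (intro divide_strict_left_mono mult_pos_pos) auto
      thus "\<exists>j\<in>{1..n}. real j * real (a j) / (exp (real j * s') - 1)
              < real j * real (a j) / (exp (real j * s) - 1)"
        using assms(1) by (intro bexI[of _ 1]) auto
    qed simp
    thus ?thesis using that S by simp
  qed
  define s1 where "s1 = ln (1 + 1 / real n)"
  have s1: "s1 > 0" unfolding s1_def using assms by (intro ln_gt_zero) simp
  have lb: "real n \<le> saddle_sum a n s1"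
  proof -
    have e: "exp s1 = 1 + 1 / real n"
      unfolding s1_def using assms by (intro exp_ln) (simp add: add_pos_nonneg)
    have "real n \<le> real n * real (a 1)" using assms by simp
    also have "\<dots> = real 1 * real (a 1) / (exp (real 1 * s1) - 1)"
      using assms by (simp add: e)
    also have "\<dots> \<le> (\<Sum>j=1..n. real j * real (a j) / (exp (real j * s1) - 1))"
      using assms s1 by (intro member_le_sum) auto
    finally show ?thesis using S[OF s1] by simp
  qed
  have "(saddle_sum a n \<longlongrightarrow> (\<Sum>j=1..n. 0)) at_top"
    unfolding saddle_sum_def
  proof (rule tendsto_sum)
    fix j assume "j \<in> {1..n}"
    hence "j > 0" by simp
    hence "filterlim (\<lambda>s. real j * s) at_top at_top"
      by (intro filterlim_tendsto_pos_mult_at_top[OF tendsto_const]) (auto simp: filterlim_ident)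
    hence "((\<lambda>s. exp (- (real j * s))) \<longlongrightarrow> 0) at_top"
      by (intro filterlim_compose[OF exp_at_bot] filterlim_uminus_at_bot_at_top[THEN filterlim_compose])
    hence "((\<lambda>s. ?t j s) \<longlongrightarrow> real j * real (a j) * 0 / (1 - 0)) at_top"
      by (intro tendsto_intros) auto
    thus "((\<lambda>s. ?t j s) \<longlongrightarrow> 0) at_top" by simp
  qed
  hence "\<forall>\<^sub>F s in at_top. saddle_sum a n s < real n"
    using assms by (intro order_tendstoD(2)[of _ 0]) auto
  hence "\<forall>\<^sub>F s in at_top. saddle_sum a n s < real n \<and> s \<ge> s1"
    using eventually_ge_at_top[of s1] by eventually_elim simp
  then obtain s2 where s2: "saddle_sum a n s2 < real n" "s1 \<le> s2"
    using eventually_happens trivial_limit_at_top_linorder by blast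
  have "continuous_on {s1..s2} (saddle_sum a n)"
    unfolding saddle_sum_def using s1 by (intro continuous_intros) auto
  then obtain s where s: "s1 \<le> s" "saddle_sum a n s = real n"
    using IVT2'[of "saddle_sum a n" s2 "real n" s1] lb s2 by auto
  show ?thesis
  proof (rule ex1I[of _ s])
    show "s > 0 \<and> saddle_sum a n s = real n" using s s1 by simp
    fix s' assume "s' > 0 \<and> saddle_sum a n s' = real n"
    thus "s' = s" using less[of s s'] less[of s' s] s s1 by (cases s s' rule: linorder_cases) auto
  qed
qed

end

(*
  The truncated product over j \<le> n already determines c_n. On the circle of radius exp (-\<sigma>_n) Cauchy's
  formula writes c_n as e^(n \<sigma>_n) \<Prod> (1 - e^(-j \<sigma>_n))^(-a_j) times the average over \<theta> of
  \<phi>(\<theta>) e^(-in\<theta>), where \<phi> is the characteristic function of a sum of independent geometric variables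
  with mean n and variance B_n^2.  So the claim is a local limit theorem.  Everything is measured by
  the gap d = \<sigma>_n - ln y, which tends to 0 while n d stays at least 6: the moment of order k has size
  d^(-r-k), hence the third order error at \<theta> = t / B_n is O(d^(r/2)), and
  \<bar>\<phi>(\<theta>)\<bar> \<le> exp (-c d^(-r) min 1 ((\<theta>/d)^2)) on the whole circle, since on a block of indices j of size
  about 1/d the sum of 1 - cos (j \<theta>) is at least a constant times d^(-1) min 1 ((\<theta>/d)^2).
  The last bound is dominated by a multiple of 1 / (1 + t^2), so dominated convergence applies.
*)
theory Submission
  imports Defs "HOL-Probability.Probability" "HOL-Complex_Analysis.Complex_Analysis"
begin

subsection \<open>Sums of regularly varying weights\<close>

text \<open>The weights are known only up to constant factors, so no asymptotic formula for
  \<sigma>_n or B_n is available and every estimate is an order of magnitude in d. The form s = d +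
  ln y of the tilt parameter treats y = 1 and y > 1 alike: exp (-js) cancels y^j exactly and leaves
  exp (-jd). The two cases still differ in the occupation numbers q / (1 - q) with q = exp (-js).
  For y > 1 they are comparable to q, but for y = 1 they grow like 1/(js) at small j, and their
  powers enter the variance and the third moment. Upper bounds therefore carry the factor 1/d + j,
  which covers both regimes, whereas lower bounds use only q on a block of indices near 1/d.\<close>

lemma powr_le_pochhammer:
  fixes r :: real
  assumes "r > 0"
  obtains C where "C > 0" "\<And>n. real n powr (r - 1) \<le> C * (pochhammer r n / fact n)"
proof -
  \<comment> \<open>These are the coefficients of (1 - x)^(-r). The ratio of n^(r-1) to them tends
    to Gamma(r), so sums of j^(r-1) x^j are bounded by a closed form for every r > 0, whether the
    weights increase or decrease.\<close>
  define b where "b n = pochhammer r n / fact n" for n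
  have b: "b n > 0" for n
    unfolding b_def using assms by (simp add: pochhammer_pos)
  have "(\<lambda>n. (-r gchoose n) / ((-1)^n / exp ((-r+1) * of_real (ln (real n))))) \<longlonglongrightarrow> inverse (Gamma r)"
    using gbinomial_asymptotic[of "-r"] by simp
  moreover have "\<forall>\<^sub>F n in sequentially. (-r gchoose n) / ((-1)^n / exp ((-r+1) * of_real (ln (real n))))
      = inverse (real n powr (r - 1) / b n)"
    using eventually_gt_at_top[of 0]
  proof eventually_elim
    case (elim n)
    have "real n powr (r - 1) = exp ((r - 1) * ln (real n))"
      using elim by (simp add: powr_def)
    then show ?case
      by (simp add: gbinomial_pochhammer b_def field_simps flip: exp_minus exp_add)
  qed
  ultimately have "(\<lambda>n. inverse (real n powr (r - 1) / b n)) \<longlonglongrightarrow> inverse (Gamma r)"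
    by (rule Lim_transform_eventually)
  from tendsto_inverse[OF this]
  have "(\<lambda>n. inverse (inverse (real n powr (r - 1) / b n))) \<longlonglongrightarrow> inverse (inverse (Gamma r))"
    using Gamma_real_pos[OF assms] by simp
  hence "(\<lambda>n. real n powr (r - 1) / b n) \<longlonglongrightarrow> Gamma r"
    by (simp only: inverse_inverse_eq)
  hence "Bseq (\<lambda>n. real n powr (r - 1) / b n)"
    by (intro convergent_imp_Bseq convergentI)
  then obtain C where C: "C > 0" "\<And>n. norm (real n powr (r - 1) / b n) \<le> C"
    by (auto simp: Bseq_def)
  have "real n powr (r - 1) \<le> C * b n" for n
    using C(2)[of n] b[of n] by (simp add: divide_le_eq abs_mult)
  with C(1) that show thesis
    unfolding b_def by blast
qed

text \<open>Take k-th powers of 1 + u \<le> exp u at u = x / (2k). Only half of an available factor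
  exp (-x) is spent, and the other half remains for summation. For k = 0 the convention 0^0 = 1
  applies.\<close>

lemma one_plus_power_le_exp:
  fixes x :: real
  assumes "x \<ge> 0"
  shows "(1 + x) ^ k \<le> (2 * real k) ^ k * exp (x / 2)"
proof (cases "k = 0")
  case False
  have "1 + x / (2 * real k) \<le> exp (x / (2 * real k))"
    by (rule exp_ge_add_one_self)
  moreover have "1 + x \<le> 2 * real k * (1 + x / (2 * real k))"
    using False assms by (simp add: field_simps)
  ultimately have "1 + x \<le> 2 * real k * exp (x / (2 * real k))"
    by (meson mult_left_mono of_nat_0_le_iff order_trans zero_le_mult_iff zero_le_numeral)
  hence "(1 + x) ^ k \<le> (2 * real k * exp (x / (2 * real k))) ^ k"
    using assms by (intro power_mono) auto
  also have "\<dots> = (2 * real k) ^ k * exp (real k * (x / (2 * real k)))"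
    by (simp only: power_mult_distrib exp_of_nat_mult)
  finally show ?thesis using False by simp
qed (use assms in auto)

lemma sum_powr_exp_le:
  fixes r :: real
  assumes r: "r > 0"
  obtains C where "C > 0" "\<And>n d. 0 < d \<Longrightarrow> d \<le> 1 \<Longrightarrow>
    (\<Sum>j=1..n. real j powr (r - 1) * exp (- (real j * d)) * (1 / d + real j) ^ k) \<le> C * d powr (- (r + real k))"
proof -
  obtain C where C: "C > 0" "\<And>n. real n powr (r - 1) \<le> C * (pochhammer r n / fact n)"
    using powr_le_pochhammer[OF r] by blast
  define K where "K = (2 * real k) ^ k"
  have K: "K > 0" unfolding K_def by (cases k) auto
  define C' where "C' = K * C * 4 powr r"
  have "(\<Sum>j=1..n. real j powr (r - 1) * exp (- (real j * d)) * (1 / d + real j) ^ k) \<le> C' * d powr (- (r + real k))"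
    if d: "0 < d" "d \<le> 1" for n d
  proof -
    \<comment> \<open>The half of exp (-jd) left after absorbing (1 + jd)^k. The sum becomes a
      binomial series at x, and 1 - x \<ge> d/4 turns its value (1 - x)^(-r) into the order
      d^(-r).\<close>
    define x where "x = exp (- (d / 2))"
    have x: "0 < x" "x < 1" using d by (auto simp: x_def)
    have "(-r gchoose j) * (-x) ^ j = pochhammer r j / fact j * x ^ j" for j
      by (simp add: gbinomial_pochhammer flip: power_mult_distrib)
    hence sums: "(\<lambda>j. pochhammer r j / fact j * x ^ j) sums (1 - x) powr (-r)"
      using gen_binomial_real[of "-x" "-r"] x by simp
    have "1 + d / 2 \<le> exp (d / 2)" by (rule exp_ge_add_one_self)
    hence "x \<le> 1 / (1 + d / 2)"
      using d unfolding x_def exp_minus inverse_eq_divide by (intro divide_left_mono) auto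
    also have "\<dots> \<le> 1 - d / 4"
    proof -
      have "1 \<le> (1 - d / 4) * (1 + d / 2)" using d mult_left_mono[of d 1 d] by (simp add: field_simps)
      thus ?thesis using d by (simp add: divide_le_eq)
    qed
    finally have x1: "d / 4 \<le> 1 - x" by simp
    have "real j powr (r - 1) * exp (- (real j * d)) * (1 / d + real j) ^ k
        \<le> K * C * d powr (- real k) * (pochhammer r j / fact j * x ^ j)" for j
    proof -
      have "(1 / d + real j) ^ k = (1 / d * (1 + real j * d)) ^ k"
        using d by (simp add: field_simps)
      also have "\<dots> = d powr (- real k) * (1 + real j * d) ^ k"
        using d by (simp add: power_mult_distrib powr_minus powr_realpow power_inverse divide_inverse)
      also have "\<dots> \<le> d powr (- real k) * (K * exp (real j * d / 2))"
        unfolding K_def using one_plus_power_le_exp d by (intro mult_left_mono) auto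
      finally have 1: "exp (- (real j * d)) * (1 / d + real j) ^ k
          \<le> exp (- (real j * d)) * (d powr (- real k) * (K * exp (real j * d / 2)))"
        by (intro mult_left_mono) auto
      have "exp (- (real j * d)) * exp (real j * d / 2) = x ^ j"
        unfolding x_def by (simp add: field_simps flip: exp_add exp_of_nat_mult)
      hence "exp (- (real j * d)) * (1 / d + real j) ^ k \<le> K * d powr (- real k) * x ^ j"
        using 1 by (simp add: mult_ac)
      hence "real j powr (r - 1) * (exp (- (real j * d)) * (1 / d + real j) ^ k)
          \<le> (C * (pochhammer r j / fact j)) * (K * d powr (- real k) * x ^ j)"
        using C(1) r d by (intro mult_mono[OF C(2)]) (auto simp: pochhammer_nonneg)
      thus ?thesis by (simp add: mult_ac)
    qed
    hence "(\<Sum>j=1..n. real j powr (r - 1) * exp (- (real j * d)) * (1 / d + real j) ^ k)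
        \<le> (\<Sum>j=1..n. K * C * d powr (- real k) * (pochhammer r j / fact j * x ^ j))"
      by (intro sum_mono) auto
    also have "\<dots> = K * C * d powr (- real k) * (\<Sum>j=1..n. pochhammer r j / fact j * x ^ j)"
      by (simp add: sum_distrib_left)
    also have "(\<Sum>j=1..n. pochhammer r j / fact j * x ^ j) \<le> (\<Sum>j. pochhammer r j / fact j * x ^ j)"
      using sums x r by (intro sum_le_suminf) (auto simp: sums_iff pochhammer_nonneg)
    also have "(\<Sum>j. pochhammer r j / fact j * x ^ j) = (1 - x) powr (-r)"
      using sums by (simp add: sums_iff)
    also have "\<dots> \<le> (d / 4) powr (-r)"
      using x1 d r by (intro powr_mono2') auto
    also have "\<dots> = 4 powr r * d powr (-r)"
      using d by (simp add: powr_divide powr_minus field_simps)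
    finally show ?thesis
      using d K C(1) by (simp add: C'_def mult_ac powr_add powr_diff powr_minus divide_inverse)
  qed
  moreover have "C' > 0" using C K by (simp add: C'_def)
  ultimately show thesis using that by blast
qed

subsection \<open>Trigonometric sums and geometric characteristic functions\<close>

lemma one_minus_cos_ge:
  fixes x :: real
  assumes "\<bar>x\<bar> \<le> 1"
  shows "1 - cos x \<ge> x\<^sup>2 / 3"
proof -
  have "cos x \<le> 1 - x\<^sup>2 / 2 + x ^ 4 / 24"
    
  proof -
    have "cos x - (1 - x\<^sup>2 / 2) = Re (iexp x - (\<Sum>k\<le>3. (\<i> * x) ^ k / fact k))"
      by (simp add: Re_exp numeral_3_eq_3 numeral_2_eq_2 power2_eq_square)
    also have "\<dots> \<le> cmod (iexp x - (\<Sum>k\<le>3. (\<i> * x) ^ k / fact k))"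
      by (rule complex_Re_le_cmod)
    also have "\<dots> \<le> \<bar>x\<bar> ^ 4 / 24"
      using iexp_approx1[of x 3] by (simp add: fact_numeral)
    finally show ?thesis by simp
  qed
  moreover have "x ^ 4 \<le> x\<^sup>2"
    using power_decreasing[of 2 4 "\<bar>x\<bar>"] assms by simp
  moreover have "x\<^sup>2 \<ge> 0" by simp
  ultimately show ?thesis by argo
qed

text \<open>Up to a factor 1/2, 1 - cos x is the squared chord from 1 to exp (ix). Chords satisfy
  the triangle inequality, and (u + v)^2 \<le> 2 (u^2 + v^2).\<close>

lemma one_minus_cos_diff_le:
  "1 - cos (a - b :: real) \<le> 2 * ((1 - cos a) + (1 - cos b))"
proof -
  have c: "1 - cos x = 2 * (sin (x / 2))\<^sup>2" for x :: real
    using cos_double_sin[of "x / 2"] by simp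
  have "\<bar>sin ((a - b) / 2)\<bar> \<le> \<bar>sin (a / 2)\<bar> * \<bar>cos (b / 2)\<bar> + \<bar>cos (a / 2)\<bar> * \<bar>sin (b / 2)\<bar>"
    unfolding diff_divide_distrib sin_diff by (metis abs_mult abs_triangle_ineq4)
  also have "\<dots> \<le> \<bar>sin (a / 2)\<bar> * 1 + 1 * \<bar>sin (b / 2)\<bar>"
    by (intro add_mono mult_mono) auto
  finally have "(sin ((a - b) / 2))\<^sup>2 \<le> (\<bar>sin (a / 2)\<bar> + \<bar>sin (b / 2)\<bar>)\<^sup>2"
    by (metis abs_ge_zero mult.right_neutral mult_1 power2_abs power_mono)
  also have "\<dots> \<le> 2 * ((sin (a / 2))\<^sup>2 + (sin (b / 2))\<^sup>2)"
    using sum_squares_bound[of "\<bar>sin (a / 2)\<bar>" "\<bar>sin (b / 2)\<bar>"] by (simp add: power2_sum)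
  finally show ?thesis unfolding c by simp
qed

lemma exists_multiple_one_minus_cos_ge:
  fixes \<theta> :: real and N :: nat
  assumes "N \<ge> 1" "\<bar>\<theta>\<bar> \<le> pi"
  obtains k where "k \<le> N" "1 - cos (real k * \<theta>) \<ge> min 1 ((real N * \<theta>)\<^sup>2) / 3"
proof -
  have mid: "1 - cos x \<ge> 1 / 3" if "1 \<le> \<bar>x\<bar>" "\<bar>x\<bar> \<le> pi" for x :: real
  proof -
    have "cos \<bar>x\<bar> \<le> cos 1" using that by (intro cos_monotone_0_pi_le) auto
    thus ?thesis using one_minus_cos_ge[of 1] by simp
  qed
  consider "\<bar>real N * \<theta>\<bar> \<le> 1" | "\<bar>real N * \<theta>\<bar> > 1" "\<bar>\<theta>\<bar> \<le> 1" | "\<bar>\<theta>\<bar> > 1" by linarith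
  thus thesis
  proof cases
    case 1
    show thesis using one_minus_cos_ge[OF 1] by (intro that[of N]) auto
  next
    case 2
    have pos: "\<bar>\<theta>\<bar> > 0" using 2 by auto
    \<comment> \<open>The first multiple of \<bar>\<theta>\<bar> to reach 1. It overshoots by at
      most \<bar>\<theta>\<bar> \<le> 1, so it lies in [1, 2], inside the range up to pi where the
      cosine is at most cos 1.\<close>
    define k where "k = nat \<lceil>1 / \<bar>\<theta>\<bar>\<rceil>"
    have k: "real k = of_int \<lceil>1 / \<bar>\<theta>\<bar>\<rceil>" unfolding k_def using pos by simp
    have "1 / \<bar>\<theta>\<bar> \<le> real N" using 2 pos by (simp add: field_simps abs_mult)
    hence "k \<le> N" unfolding k_def by (simp add: nat_le_iff ceiling_le_iff)
    moreover have "1 / \<bar>\<theta>\<bar> \<le> real k" "real k \<le> 1 / \<bar>\<theta>\<bar> + 1" unfolding k by linarith+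
    hence "1 \<le> \<bar>real k * \<theta>\<bar>" "\<bar>real k * \<theta>\<bar> \<le> 1 + \<bar>\<theta>\<bar>"
      using pos by (auto simp: field_simps abs_mult)
    hence "1 - cos (real k * \<theta>) \<ge> 1 / 3" using 2 pi_gt3 by (intro mid) auto
    ultimately show thesis by (intro that[of k]) auto
  next
    case 3
    have "1 - cos (real 1 * \<theta>) \<ge> 1 / 3" using 3 assms by (intro mid) auto
    thus thesis using assms by (intro that[of 1]) auto
  qed
qed

text \<open>Pair j with j + k for N \<le> j < 2N. The two angles differ by k\<theta>, which is far
  from 0 for a suitable k \<le> N, so they cannot both be close to multiples of 2 pi; k \<le> N
  keeps both indices in the window. The constant is 12 = 3 * 4: the pair inequality costs 2, and two
  sums are each bounded by the whole window.\<close>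

lemma sum_one_minus_cos_ge:
  fixes \<theta> :: real and N :: nat
  assumes "N \<ge> 1" "\<bar>\<theta>\<bar> \<le> pi"
  shows "(\<Sum>j=N..3*N. 1 - cos (real j * \<theta>)) \<ge> real N * min 1 ((real N * \<theta>)\<^sup>2) / 12"
proof -
  obtain k where k: "k \<le> N" "1 - cos (real k * \<theta>) \<ge> min 1 ((real N * \<theta>)\<^sup>2) / 3"
    using exists_multiple_one_minus_cos_ge[OF assms] by blast
  define S where "S = (\<Sum>j=N..3*N. 1 - cos (real j * \<theta>))"
  have "real N * (1 - cos (real k * \<theta>)) = (\<Sum>j=N..<2*N. 1 - cos (real (j + k) * \<theta> - real j * \<theta>))"
    by (simp add: algebra_simps)
  also have "\<dots> \<le> (\<Sum>j=N..<2*N. 2 * ((1 - cos (real (j + k) * \<theta>)) + (1 - cos (real j * \<theta>))))"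
    by (intro sum_mono one_minus_cos_diff_le)
  also have "\<dots> = 2 * ((\<Sum>j=N..<2*N. 1 - cos (real (j + k) * \<theta>)) + (\<Sum>j=N..<2*N. 1 - cos (real j * \<theta>)))"
    by (simp only: sum.distrib flip: sum_distrib_left)
  also have "(\<Sum>j=N..<2*N. 1 - cos (real (j + k) * \<theta>)) = (\<Sum>j=N+k..<2*N+k. 1 - cos (real j * \<theta>))"
    by (rule sum.shift_bounds_nat_ivl[symmetric])
  also have "\<dots> \<le> S"
    unfolding S_def using k(1) by (intro sum_mono2) auto
  also have "(\<Sum>j=N..<2*N. 1 - cos (real j * \<theta>)) \<le> S"
    unfolding S_def by (intro sum_mono2) auto
  finally have "real N * (1 - cos (real k * \<theta>)) \<le> 4 * S" by simp
  moreover have "real N * (min 1 ((real N * \<theta>)\<^sup>2) / 3) \<le> real N * (1 - cos (real k * \<theta>))"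
    by (intro mult_left_mono k(2)) auto
  ultimately show ?thesis unfolding S_def by simp
qed

section \<open>Modulus and logarithm of geometric characteristic functions\<close>

lemma norm_one_minus_cis_sq: "(norm (1 - of_real q * cis x))\<^sup>2 = (1 - q)\<^sup>2 + 2 * q * (1 - cos x)"
proof -
  have "(norm (1 - of_real q * cis x))\<^sup>2 = (1 - q * cos x)\<^sup>2 + (q * sin x)\<^sup>2"
    by (simp add: cmod_power2)
  also have "\<dots> = 1 - 2 * q * cos x + q\<^sup>2 * ((cos x)\<^sup>2 + (sin x)\<^sup>2)"
    by (simp only: power2_eq_square) algebra
  finally show ?thesis by (simp add: power2_eq_square algebra_simps)
qed

text \<open>With u = 2q (1 - cos x) the squared modulus is (1-q)^2 / ((1-q)^2 + u). Replacing
  (1-q)^2 by 1 increases it to 1 / (1 + u), a bound that stays valid uniformly as q tends to 1. The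
  5 is the maximum of 1 + u.\<close>

lemma norm_geometric_char_le:
  assumes "0 < q" "q < (1 :: real)"
  shows "norm (of_real (1 - q) / (1 - of_real q * cis x)) \<le> exp (- (q * (1 - cos x) / 5))"
proof -
  define u where "u = 2 * q * (1 - cos x)"
  have u: "0 \<le> u" "u \<le> 4"
  proof -
    show "0 \<le> u" unfolding u_def using assms by simp
    have "q * (1 - cos x) \<le> 1 * 2" using assms cos_ge_minus_one[of x] cos_le_one[of x] by (intro mult_mono) linarith+
    thus "u \<le> 4" unfolding u_def by simp
  qed
  have pos: "(1 - q)\<^sup>2 > 0" using assms by simp
  have pos2: "(1 - q)\<^sup>2 + u > 0" using pos u by linarith
  have "(1 - q)\<^sup>2 * (1 + u) \<le> (1 - q)\<^sup>2 + u"
  proof -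
    have "(1 - q)\<^sup>2 * u \<le> 1 * u" using assms u by (intro mult_right_mono power_le_one) auto
    thus ?thesis by (simp add: algebra_simps)
  qed
  hence "(norm (of_real (1 - q) / (1 - of_real q * cis x)))\<^sup>2 \<le> 1 / (1 + u)"
    unfolding norm_divide power_divide norm_one_minus_cis_sq u_def[symmetric]
    using u pos pos2 by (simp add: divide_simps norm_of_real del: of_real_diff) 
  also have "1 / (1 + u) = 1 + (- (u / (1 + u)))" using u by (simp add: field_simps)
  also have "\<dots> \<le> exp (- (u / (1 + u)))" by (rule exp_ge_add_one_self)
  also have "\<dots> \<le> exp (- (u / 5))" using divide_left_mono[of "1 + u" 5 u] u by simp
  also have "\<dots> = (exp (- (q * (1 - cos x) / 5)))\<^sup>2"
    by (simp add: u_def flip: exp_double)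
  finally show ?thesis by (rule power2_le_imp_le) simp
qed

text \<open>The remainder vanishes at 0 and has derivative -z^2 / (1 - z), which is at most 2
  \<bar>w\<bar>^2 in modulus on the disc of radius \<bar>w\<bar> \<le> 1/2; the mean value
  inequality supplies the third power.\<close>

lemma Ln_one_minus_approx:
  fixes w :: complex
  assumes "norm w \<le> 1 / 2"
  shows "norm (Ln (1 - w) + w + w\<^sup>2 / 2) \<le> 2 * norm w ^ 3"
proof -
  define g where "g = (\<lambda>z::complex. Ln (1 - z) + z + z\<^sup>2 / 2)"
  define S where "S = cball (0::complex) (norm w)"
  have deriv: "(g has_field_derivative (- (z\<^sup>2) / (1 - z))) (at z within S)" if "z \<in> S" for z
  proof -
    have z: "norm z \<le> 1 / 2" using that assms by (simp add: S_def)
    have "Re z \<le> norm z" by (rule complex_Re_le_cmod)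
    hence "1 - z \<notin> \<real>\<^sub>\<le>\<^sub>0" using z by (auto simp: complex_nonpos_Reals_iff)
    moreover have "1 - z \<noteq> 0" using z by auto
    ultimately show ?thesis
      unfolding g_def by (auto intro!: derivative_eq_intros simp: field_simps power2_eq_square)
  qed
  have bound: "norm (- (z\<^sup>2) / (1 - z)) \<le> 2 * norm w ^ 2" if "z \<in> S" for z
  proof -
    have z: "norm z \<le> 1 / 2" "norm z \<le> norm w" using that assms by (auto simp: S_def)
    have "norm (1 - z) \<ge> 1 / 2" using norm_triangle_ineq2[of 1 z] z by simp
    hence "norm z ^ 2 / norm (1 - z) \<le> norm w ^ 2 / (1 / 2)"
      using z by (intro frac_le power_mono) auto
    thus ?thesis by (simp add: norm_divide norm_power)
  qed
  have "norm (g w - g 0) \<le> 2 * norm w ^ 2 * norm (w - 0)"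
    by (rule field_differentiable_bound[OF _ deriv bound]) (auto simp: S_def)
  thus ?thesis by (simp add: g_def power3_eq_cube power2_eq_square)
qed

text \<open>The geometric law with mean m has variance m + m^2 and characteristic function 1 / (1 -
  m (exp (ix) - 1)); \<open>L\<close> is a logarithm of it. The bound on m \<bar>x\<bar> keeps m
  (exp (ix) - 1) in the disc where the logarithm is expanded.\<close>

lemma geometric_char_approx:
  fixes m x :: real
  assumes "m \<ge> 0" "m * \<bar>x\<bar> \<le> 1 / 2"
  obtains L where "1 / (1 - of_real m * (cis x - 1)) = exp L"
    "norm (L - (\<i> * of_real (m * x) - of_real ((m + m\<^sup>2) * x\<^sup>2 / 2))) \<le> 2 * (m + m\<^sup>2 + m ^ 3) * \<bar>x\<bar> ^ 3"
proof -
  define w where "w = of_real m * (cis x - 1)"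
  have e: "iexp x = cis x" by (simp add: cis_conv_exp)
  have c1: "norm (cis x - 1) \<le> \<bar>x\<bar>" using iexp_approx1[of x 0] e by simp
  have c2: "norm (cis x - 1 - \<i> * x) \<le> \<bar>x\<bar> ^ 2 / 2"
    using iexp_approx1[of x 1] e by (simp add: numeral_2_eq_2 algebra_simps)
  have c3: "norm (cis x - 1 - \<i> * x + x ^ 2 / 2) \<le> \<bar>x\<bar> ^ 3 / 6"
    using iexp_approx1[of x 2] e by (simp add: numeral_2_eq_2 numeral_3_eq_3 algebra_simps)
  have w: "norm w \<le> m * \<bar>x\<bar>"
    unfolding w_def using c1 assms by (simp add: norm_mult mult_left_mono)
  hence w2: "norm w \<le> 1 / 2" using assms by linarith
  hence nz: "1 - w \<noteq> 0" by auto
  define L where "L = - Ln (1 - w)"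
  have "exp L = 1 / (1 - w)" unfolding L_def using nz by (simp add: exp_minus divide_inverse)
  moreover have "norm (L - (\<i> * of_real (m * x) - of_real ((m + m\<^sup>2) * x\<^sup>2 / 2)))
      \<le> 2 * (m + m\<^sup>2 + m ^ 3) * \<bar>x\<bar> ^ 3"
  proof -
    \<comment> \<open>The linear term in m needs the Taylor expansion of \<open>cis x\<close> to
      order two. In the quadratic one, (cis x - 1)^2 + x^2 factors as (cis x - 1 - ix) (cis x - 1 +
      ix), so order one suffices.\<close>
    have "L - (\<i> * of_real (m * x) - of_real ((m + m\<^sup>2) * x\<^sup>2 / 2))
       = - (Ln (1 - w) + w + w\<^sup>2 / 2) + of_real m * (cis x - 1 - \<i> * x + x ^ 2 / 2)
         + of_real (m\<^sup>2 / 2) * ((cis x - 1 - \<i> * x) * ((cis x - 1) + \<i> * x))"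
      unfolding L_def w_def by (simp add: algebra_simps power2_eq_square add_divide_distrib diff_divide_distrib)
    also have "norm \<dots> \<le> 2 * (m * \<bar>x\<bar>) ^ 3 + m * (\<bar>x\<bar> ^ 3 / 6) + (m\<^sup>2 / 2) * (\<bar>x\<bar> ^ 2 / 2 * (\<bar>x\<bar> + \<bar>x\<bar>))"
    proof (intro norm_triangle_mono)
      have "norm (- (Ln (1 - w) + w + w\<^sup>2 / 2)) \<le> 2 * norm w ^ 3"
        using Ln_one_minus_approx[OF w2] by (simp only: norm_minus_cancel)
      also have "\<dots> \<le> 2 * (m * \<bar>x\<bar>) ^ 3" using w by (intro mult_left_mono power_mono) auto
      finally show "norm (- (Ln (1 - w) + w + w\<^sup>2 / 2)) \<le> 2 * (m * \<bar>x\<bar>) ^ 3" .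
      show "norm (of_real m * (cis x - 1 - \<i> * x + x ^ 2 / 2)) \<le> m * (\<bar>x\<bar> ^ 3 / 6)"
        unfolding norm_mult using assms by (intro mult_mono c3) auto
      have "norm ((cis x - 1) + \<i> * x) \<le> \<bar>x\<bar> + \<bar>x\<bar>"
        using norm_triangle_ineq[of "cis x - 1" "\<i> * x"] c1 by (simp add: norm_mult)
      thus "norm (of_real (m\<^sup>2 / 2) * ((cis x - 1 - \<i> * x) * ((cis x - 1) + \<i> * x)))
          \<le> (m\<^sup>2 / 2) * (\<bar>x\<bar> ^ 2 / 2 * (\<bar>x\<bar> + \<bar>x\<bar>))"
        unfolding norm_mult using c2 by (intro mult_mono) (auto simp: norm_power norm_divide)
    qed
    also have "\<dots> = (2 * m ^ 3 + m / 6 + m\<^sup>2 / 2) * \<bar>x\<bar> ^ 3"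
      by (simp add: power_mult_distrib power2_eq_square power3_eq_cube algebra_simps)
    also have "\<dots> \<le> 2 * (m + m\<^sup>2 + m ^ 3) * \<bar>x\<bar> ^ 3"
      using assms by (intro mult_right_mono) (auto intro!: add_mono simp: distrib_left)
    finally show ?thesis .
  qed
  ultimately show thesis using that[of L] unfolding w_def by simp
qed

subsection \<open>Coefficients as Cauchy integrals\<close>

lemma fps_nth_has_integral:
  fixes f :: "complex \<Rightarrow> complex"
  assumes f: "f holomorphic_on ball 0 R" and F: "f has_fps_expansion F" and \<rho>: "0 < \<rho>" "\<rho> < R"
  shows "((\<lambda>\<theta>. f (of_real \<rho> * cis \<theta>) / (of_real \<rho> * cis \<theta>) ^ n) has_integral (2 * pi * fps_nth F n)) {-pi..pi}"
proof -
  \<comment> \<open>The circle is parametrised over \<open>{0..2*pi}\<close>, while the estimates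
    need \<bar>\<theta>\<bar> \<le> pi. Translating the angle by pi is the reflection z -> -z, which
    \<open>g\<close> undoes at the cost of the sign (-1)^n.\<close>
  define g where "g = (\<lambda>z. f (- 1 * z))"
  have g: "g holomorphic_on ball 0 R"
    unfolding g_def using f
    by (intro holomorphic_on_compose_gen[of "\<lambda>z. -1 * z" _ f "ball 0 R", unfolded o_def] holomorphic_intros) auto
  have sub: "cball 0 \<rho> \<subseteq> ball (0::complex) R" "ball 0 \<rho> \<subseteq> ball (0::complex) R" using \<rho> by auto
  have "((\<lambda>u. g u / (u - 0) ^ Suc n) has_contour_integral ((2 * pi * \<i>) / (fact n) * (deriv ^^ n) g 0)) (circlepath 0 \<rho>)"
    using \<rho> g sub
    by (intro Cauchy_has_contour_integral_higher_derivative_circlepath)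
       (use holomorphic_on_subset[OF g sub(1)] holomorphic_on_subset[OF g sub(2)] in \<open>auto intro: holomorphic_on_imp_continuous_on\<close>)
  also have "(deriv ^^ n) g 0 = (-1) ^ n * (deriv ^^ n) f (-1 * 0)"
    unfolding g_def using \<rho>
    by (intro higher_deriv_compose_linear[OF f, of "ball 0 R"]) auto
  also have "(deriv ^^ n) f (-1 * 0) = fact n * fps_nth F n"
    using fps_nth_fps_expansion[OF F, of n] by simp
  finally have 1: "((\<lambda>t. g (0 + \<rho> * cis t) / (0 + \<rho> * cis t - 0) ^ Suc n * \<rho> * \<i> * cis t)
      has_integral ((2 * pi * \<i>) / (fact n) * ((-1) ^ n * (fact n * fps_nth F n)))) {0..2*pi}"
    unfolding circlepath_def by (subst (asm) has_contour_integral_part_circlepath_iff) auto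
  have eq: "g (0 + \<rho> * cis t) / (0 + \<rho> * cis t - 0) ^ Suc n * \<rho> * \<i> * cis t
      = \<i> * (g (\<rho> * cis t) / (\<rho> * cis t) ^ n)" for t
    using \<rho> by (simp add: field_simps)
  define c where "c = complex_of_real (2 * pi) * fps_nth F n"
  have "((\<lambda>t. \<i> * (g (\<rho> * cis t) / (\<rho> * cis t) ^ n)) has_integral (\<i> * ((-1) ^ n * c))) {0..2*pi}"
    using 1 unfolding eq by (simp add: c_def field_simps)
  from has_integral_mult_right[OF this, of "-\<i> * (-1) ^ n"]
  have "((\<lambda>t. (-\<i> * (-1) ^ n) * (\<i> * (g (\<rho> * cis t) / (\<rho> * cis t) ^ n))) has_integral
      (-\<i> * (-1) ^ n) * (\<i> * ((-1) ^ n * c))) {0..2*pi}" .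
  moreover have "(-\<i> * e) * (\<i> * z) = e * z" for e z :: complex
    by (simp add: complex_eq_iff algebra_simps)
  moreover have "(-1) ^ n * ((-1) ^ n * c) = c"
    by (simp flip: power_mult_distrib mult.assoc)
  ultimately have 2: "((\<lambda>t. (-1) ^ n * (g (\<rho> * cis t) / (\<rho> * cis t) ^ n)) has_integral c) {0..2*pi}"
    by (simp only:)
  have 3: "(-1) ^ n * (g (\<rho> * cis (\<theta> + pi)) / (\<rho> * cis (\<theta> + pi)) ^ n) = f (\<rho> * cis \<theta>) / (\<rho> * cis \<theta>) ^ n" for \<theta>
  proof -
    have "\<rho> * cis (\<theta> + pi) = -1 * (\<rho> * cis \<theta>)" by (simp add: cis_mult[symmetric])
    moreover have "(-1) ^ n * (f (-1 * (-1 * z)) / (-1 * z) ^ n) = f z / z ^ n" for z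
      unfolding power_mult_distrib by simp
    ultimately show ?thesis unfolding g_def by (simp only:)
  qed
  have "((\<lambda>\<theta>. (-1) ^ n * (g (\<rho> * cis (\<theta> + pi)) / (\<rho> * cis (\<theta> + pi)) ^ n)) has_integral c) {-pi..pi}"
    using 2 has_integral_shift_Icc_real[of "\<lambda>t. (-1) ^ n * (g (\<rho> * cis t) / (\<rho> * cis t) ^ n)" pi _ "-pi" pi]
    by (simp add: o_def add.commute)
  thus ?thesis unfolding 3 c_def by simp
qed

section \<open>The truncated product and its Cauchy integral\<close>

lemma fps_nth_mult_inverse_power:
  fixes A :: "'a :: field fps"
  assumes "n < s"
  shows "fps_nth (A * inverse (1 - fps_X ^ s) ^ k) n = fps_nth A n"
proof (induction k arbitrary: A)
  case (Suc k)
  define u :: "'a fps" where "u = inverse (1 - fps_X ^ s)"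
  have "(1 - fps_X ^ s) * u = 1"
    unfolding u_def using assms by (intro inverse_mult_eq_1') auto
  moreover have "A * u = A * ((1 - fps_X ^ s) * u) + fps_X ^ s * (A * u)"
    by (simp add: algebra_simps)
  ultimately have "A * u = A + fps_X ^ s * (A * u)" by simp
  hence "fps_nth (A * u) n = fps_nth A n + fps_nth (fps_X ^ s * (A * u)) n"
    by (metis fps_add_nth)
  also have "\<dots> = fps_nth A n"
    using assms by (simp add: fps_X_power_mult_nth)
  finally show ?case
    using Suc[of "A * u"] by (simp add: u_def mult_ac)
qed auto

text \<open>Convergence of formal power series makes each coefficient eventually constant, and
  factors for sizes above n leave coefficient n alone.\<close>

lemma multiset_count_eq_finite_prod:
  "multiset_count a n = fps_nth (\<Prod>j=1..n. inverse (1 - fps_X ^ j) ^ a j) n"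
proof -
  define f :: "nat \<Rightarrow> real fps" where "f = (\<lambda>j. inverse (1 - fps_X ^ Suc j) ^ a (Suc j))"
  have stab: "fps_nth (\<Prod>j<n+m. f j) n = fps_nth (\<Prod>j<n. f j) n" for m
    by (induction m) (auto simp: f_def fps_nth_mult_inverse_power simp del: power_Suc)
  have "(\<lambda>m. \<Prod>j\<le>m. f j) \<longlonglongrightarrow> multiset_gf a"
    using has_prod_imp_tendsto[OF multiset_gf_has_prod[of a]] by (simp only: f_def)
  hence "\<forall>\<^sub>F m in sequentially. fps_nth (\<Prod>j\<le>m. f j) n = multiset_count a n"
    unfolding tendsto_fps_iff multiset_count_def by simp
  hence "\<forall>\<^sub>F m in sequentially. fps_nth (\<Prod>j\<le>m. f j) n = multiset_count a n \<and> m \<ge> n"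
    using eventually_ge_at_top[of n] by eventually_elim simp
  then obtain m where m: "fps_nth (\<Prod>j\<le>m. f j) n = multiset_count a n" "m \<ge> n"
    using eventually_happens trivial_limit_sequentially by blast
  have "{..m} = {..<n + (Suc m - n)}" using m(2) by auto
  hence "multiset_count a n = fps_nth (\<Prod>j<n. f j) n"
    using m stab[of "Suc m - n"] by simp
  also have "(\<Prod>j<n. f j) = (\<Prod>j=1..n. inverse (1 - fps_X ^ j) ^ a j)"
    unfolding f_def by (rule prod.reindex_bij_witness[of _ "\<lambda>j. j - 1" Suc]) auto
  finally show ?thesis .
qed

text \<open>Cauchy's formula needs complex coefficients, while the counting series is real. The
  embedding respects products, powers and inverses, so it can be applied factor by factor.\<close>

definition fps_of_real :: "real fps \<Rightarrow> complex fps" where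
  "fps_of_real F = Abs_fps (\<lambda>k. of_real (fps_nth F k))"

lemma fps_of_real_nth [simp]: "fps_nth (fps_of_real F) n = of_real (fps_nth F n)"
  by (simp add: fps_of_real_def)

lemma fps_of_real_1 [simp]: "fps_of_real 1 = 1"
  and fps_of_real_X [simp]: "fps_of_real fps_X = fps_X"
  and fps_of_real_diff: "fps_of_real (F - G) = fps_of_real F - fps_of_real G"
  and fps_of_real_mult: "fps_of_real (F * G) = fps_of_real F * fps_of_real G"
  by (auto simp: fps_eq_iff fps_mult_nth)

lemma fps_of_real_power: "fps_of_real (F ^ k) = fps_of_real F ^ k"
  by (induction k) (auto simp: fps_of_real_mult)

lemma fps_of_real_prod: "fps_of_real (\<Prod>j\<in>S. F j) = (\<Prod>j\<in>S. fps_of_real (F j))"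
  by (induction S rule: infinite_finite_induct) (auto simp: fps_of_real_mult)

lemma fps_of_real_inverse:
  assumes "fps_nth F 0 \<noteq> 0"
  shows "fps_of_real (inverse F) = inverse (fps_of_real F)"
proof -
  have "fps_of_real F * fps_of_real (inverse F) = 1"
    using inverse_mult_eq_1'[OF assms] by (simp flip: fps_of_real_mult)
  thus ?thesis by (rule fps_inverse_unique[symmetric])
qed

text \<open>The truncated product has its poles on the unit circle only, so every radius below 1 is
  admissible, whatever the radius of convergence of the infinite product.\<close>

lemma multiset_count_has_integral:
  fixes \<rho> :: real
  assumes "0 < \<rho>" "\<rho> < 1"
  shows "((\<lambda>\<theta>. (\<Prod>j=1..n. inverse (1 - (\<rho> * cis \<theta>) ^ j) ^ a j) / (\<rho> * cis \<theta>) ^ n)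
    has_integral of_real (2 * pi * multiset_count a n)) {-pi..pi}"
proof -
  define f where "f = (\<lambda>z::complex. \<Prod>j=1..n. inverse (1 - z ^ j) ^ a j)"
  have nz: "1 - z ^ j \<noteq> 0" if "z \<in> ball 0 1" "j \<in> {1..n}" for z :: complex and j
  proof
    assume "1 - z ^ j = 0"
    hence "norm z ^ j = 1" by (metis eq_iff_diff_eq_0 norm_one norm_power)
    moreover have "norm z ^ j < 1" using that by (intro power_less_one_iff[THEN iffD2]) auto
    ultimately show False by simp
  qed
  have "f holomorphic_on ball 0 1"
    unfolding f_def using nz by (intro holomorphic_intros) auto
  moreover have "f has_fps_expansion fps_of_real (\<Prod>j=1..n. inverse (1 - fps_X ^ j) ^ a j)"
  proof (rule has_fps_expansion_schematicI)
    show "f has_fps_expansion (\<Prod>j=1..n. inverse (1 - fps_X ^ j) ^ a j)"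
      unfolding f_def by (intro fps_expansion_intros) auto
    show "(\<Prod>j=1..n. inverse (1 - fps_X ^ j) ^ a j) = fps_of_real (\<Prod>j=1..n. inverse (1 - fps_X ^ j) ^ a j)"
      unfolding fps_of_real_prod fps_of_real_power
      by (intro prod.cong refl) (simp add: fps_of_real_inverse fps_of_real_diff fps_of_real_power)
  qed
  ultimately have "((\<lambda>\<theta>. f (of_real \<rho> * cis \<theta>) / (of_real \<rho> * cis \<theta>) ^ n) has_integral
      (2 * pi * of_real (multiset_count a n))) {-pi..pi}"
    using assms fps_nth_has_integral[of f 1 "fps_of_real (\<Prod>j=1..n. inverse (1 - fps_X ^ j) ^ a j)" \<rho> n]
    by (simp add: multiset_count_eq_finite_prod)
  thus ?thesis by (simp add: f_def)
qed

subsection \<open>The tilted distribution\<close>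

text \<open>The mean of the geometric distribution with ratio \<open>exp (- j s)\<close> (the Bose occupation number).\<close>

definition occ :: "real \<Rightarrow> nat \<Rightarrow> real" where
  "occ s j = exp (- (real j * s)) / (1 - exp (- (real j * s)))"

section \<open>Estimates for occupation numbers\<close>

lemma occ_ge_exp: "s > 0 \<Longrightarrow> j \<ge> 1 \<Longrightarrow> exp (- (real j * s)) \<le> occ s j"
  unfolding occ_def by (simp add: le_divide_eq mult_left_le)

lemma occ_nonneg: "s > 0 \<Longrightarrow> j \<ge> 1 \<Longrightarrow> 0 \<le> occ s j"
  using occ_ge_exp[of s j] by (meson exp_ge_zero order_trans)

lemma occ_altdef: "occ s j = 1 / (exp (real j * s) - 1)"
  by (simp add: occ_def exp_minus field_simps)

lemma occ_antimono: "0 < s \<Longrightarrow> s \<le> s' \<Longrightarrow> j \<ge> 1 \<Longrightarrow> occ s' j \<le> occ s j"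
  unfolding occ_altdef by (intro divide_left_mono mult_pos_pos) auto

lemma mult_occ_le_inverse:
  assumes "s > 0" "j \<ge> 1"
  shows "real j * occ s j \<le> 1 / s"
proof -
  have "real j * s > 0" using assms by simp
  moreover have "real j * s \<le> exp (real j * s) - 1" using exp_ge_add_one_self[of "real j * s"] by linarith
  ultimately have "1 / (exp (real j * s) - 1) \<le> 1 / (real j * s)" by (intro divide_left_mono) auto
  hence "real j * occ s j \<le> real j * (1 / (real j * s))"
    unfolding occ_altdef by (intro mult_left_mono) auto
  thus ?thesis using assms by simp
qed

text \<open>Use occ = q (1 + occ) with q = exp (-js): the inner occ is bounded by 1/(js), and the
  outer q preserves the decay in j that the bound 1/s alone would lose.\<close>

lemma mult_occ_le:
  assumes "s > 0" "j \<ge> 1"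
  shows "real j * occ s j \<le> exp (- (real j * s)) * (1 / s + real j)"
proof -
  define X where "X = exp (real j * s)"
  have "X > 1" using assms by (simp add: X_def)
  hence "1 / (X - 1) = inverse X * (1 + 1 / (X - 1))"
    by (simp add: divide_simps)
  hence "occ s j = exp (- (real j * s)) * (1 + occ s j)"
    unfolding occ_altdef exp_minus X_def .
  hence "real j * occ s j = exp (- (real j * s)) * (real j + real j * occ s j)"
    by (metis distrib_left mult.left_commute mult.right_neutral)
  also have "\<dots> \<le> exp (- (real j * s)) * (1 / s + real j)"
    using mult_occ_le_inverse[OF assms] by (intro mult_left_mono) auto
  finally show ?thesis .
qed

text \<open>Of the k exponential factors one is kept, since one is what cancels the growth y^j of
  the weights; the others are at most 1. With 1/s \<le> 1/d all powers k share one majorant, of the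
  shape summed in \<open>sum_powr_exp_le\<close>.\<close>

lemma power_occ_le:
  assumes "0 < d" "d \<le> s" "j \<ge> 1" "1 \<le> k" "k \<le> K"
  shows "real j ^ K * occ s j ^ k \<le> exp (- (real j * s)) * (1 / d + real j) ^ K"
proof -
  define b where "b = 1 / d + real j"
  have s: "s > 0" and b: "b \<ge> 0" "real j \<le> b" using assms by (auto simp: b_def)
  have e: "exp (- (real j * s)) \<le> 1" using s by simp
  have "real j * occ s j \<le> exp (- (real j * s)) * (1 / s + real j)"
    using mult_occ_le assms s by simp
  also have "\<dots> \<le> exp (- (real j * s)) * b"
    unfolding b_def using assms by (intro mult_left_mono add_right_mono divide_left_mono) auto
  finally have 1: "real j * occ s j \<le> exp (- (real j * s)) * b" .
  have "real j ^ K * occ s j ^ k = real j ^ (K - k) * (real j * occ s j) ^ k"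
    using assms by (simp add: power_mult_distrib flip: power_add mult.assoc)
  also have "\<dots> \<le> b ^ (K - k) * (exp (- (real j * s)) * b) ^ k"
    using b occ_nonneg[OF s assms(3)] by (intro mult_mono power_mono[OF 1] power_mono[OF b(2)]) auto
  also have "\<dots> = exp (- (real j * s)) ^ k * b ^ K"
    using assms by (simp add: power_mult_distrib flip: power_add)
  also have "\<dots> \<le> exp (- (real j * s)) ^ 1 * b ^ K"
    using b e assms by (intro mult_right_mono power_decreasing) auto
  finally show ?thesis by (simp add: b_def)
qed

text \<open>The right side is the maximum over u, attained at u = p/c; the bound is ln v \<le> v - 1
  at v = cu/p.\<close>

lemma powr_mult_exp_bounded:
  fixes c p u :: real
  assumes "c > 0" "p > 0" "u > 0"
  shows "u powr p * exp (- (c * u)) \<le> exp (p * ln (p / c) - p)"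
proof -
  have "ln (c * u / p) \<le> c * u / p - 1"
    using assms by (intro ln_le_minus_one) auto
  hence "p * ln (c * u / p) \<le> p * (c * u / p - 1)" using assms by (intro mult_left_mono) auto
  also have "\<dots> = c * u - p" using assms by (simp add: field_simps)
  finally have "p * ln u - c * u \<le> p * ln (p / c) - p"
    using assms by (simp add: ln_mult ln_div algebra_simps)
  moreover have "u powr p * exp (- (c * u)) = exp (p * ln u - c * u)"
    using assms by (simp add: powr_def exp_diff exp_minus divide_inverse)
  ultimately show ?thesis by simp
qed

lemma power_eq_exp_ln: "y > 0 \<Longrightarrow> y ^ j = exp (real j * ln y)" for y :: real
  by (simp add: exp_of_nat_mult)

text \<open>The characteristic function of the sum over \<open>j \<le> n\<close> of \<open>j\<close> times \<open>a j\<close> independent geometric variables with ratio \<open>exp (- j s)\<close>.\<close>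

definition tilt :: "(nat \<Rightarrow> nat) \<Rightarrow> nat \<Rightarrow> real \<Rightarrow> real \<Rightarrow> complex" where
  "tilt a n s \<theta> = (\<Prod>j=1..n. (of_real (1 - exp (- (real j * s))) /
     (1 - of_real (exp (- (real j * s))) * cis (real j * \<theta>))) ^ a j)"

lemma one_minus_mult_cis_nonzero:
  assumes "\<bar>q\<bar> < (1 :: real)"
  shows "1 - of_real q * cis x \<noteq> 0"
proof
  assume "1 - of_real q * cis x = 0"
  hence "norm (of_real q * cis x) = 1" by (metis eq_iff_diff_eq_0 norm_one)
  thus False using assms by (simp add: norm_mult)
qed

lemma continuous_on_tilt: "s > 0 \<Longrightarrow> continuous_on S (tilt a n s)"
  unfolding tilt_def using one_minus_mult_cis_nonzero
  by (intro continuous_intros) (auto simp del: of_real_exp)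

text \<open>The exponents are sums of nonnegative terms, so they may be restricted to any set of
  indices; the set used is a block near 1/d.\<close>

lemma norm_tilt_le:
  assumes s: "s > 0" and S: "S \<subseteq> {1..n}"
  shows "norm (tilt a n s \<theta>) \<le> exp (- (\<Sum>j\<in>S. real (a j) * exp (- (real j * s)) * (1 - cos (real j * \<theta>))) / 5)"
proof -
  have "norm (tilt a n s \<theta>) \<le> (\<Prod>j=1..n. exp (- (exp (- (real j * s)) * (1 - cos (real j * \<theta>)) / 5)) ^ a j)"
    unfolding tilt_def prod_norm[symmetric] norm_power using s
    by (intro prod_mono conjI power_mono norm_geometric_char_le zero_le_power norm_ge_zero) auto
  also have "\<dots> = exp (- (\<Sum>j=1..n. real (a j) * exp (- (real j * s)) * (1 - cos (real j * \<theta>))) / 5)"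
    by (simp add: sum_divide_distrib mult.assoc flip: exp_of_nat_mult exp_sum sum_negf)
  also have "\<dots> \<le> exp (- (\<Sum>j\<in>S. real (a j) * exp (- (real j * s)) * (1 - cos (real j * \<theta>))) / 5)"
    using S by (simp add: sum_mono2 divide_right_mono)
  finally show ?thesis .
qed

text \<open>The variance of the tilted sum: a geometric variable with mean m has variance m +
  m^2.\<close>

definition tilt_var :: "(nat \<Rightarrow> nat) \<Rightarrow> nat \<Rightarrow> real \<Rightarrow> real" where
  "tilt_var a n s = (\<Sum>j=1..n. real (a j) * (real j)\<^sup>2 * (occ s j + occ s j ^ 2))"

text \<open>The range of \<theta> comes from j occ \<le> 1/s, which makes the mean times the angle
  j\<theta> at most 1/2 for all j at once. Logarithms are chosen for the single factors and added,
  so no branch for the product has to be fixed. The factor \<open>cis\<close> on the left removes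
  the mean.\<close>

lemma tilt_approx:
  assumes s: "s > 0" and \<theta>: "\<bar>\<theta>\<bar> \<le> s / 2"
  obtains E where
    "tilt a n s \<theta> * cis (- (\<Sum>j=1..n. real (a j) * (real j * occ s j)) * \<theta>)
       = exp (of_real (- tilt_var a n s * \<theta>\<^sup>2 / 2) + E)"
    "norm E \<le> 2 * (\<Sum>j=1..n. real (a j) * real j ^ 3 * (occ s j + occ s j ^ 2 + occ s j ^ 3)) * \<bar>\<theta>\<bar> ^ 3"
proof -
  have ex: "\<exists>L. of_real (1 - exp (- (real j * s))) / (1 - of_real (exp (- (real j * s))) * cis (real j * \<theta>)) = exp L
      \<and> norm (L - (\<i> * of_real (occ s j * (real j * \<theta>)) - of_real ((occ s j + occ s j ^ 2) * (real j * \<theta>)\<^sup>2 / 2)))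
         \<le> 2 * (occ s j + occ s j ^ 2 + occ s j ^ 3) * \<bar>real j * \<theta>\<bar> ^ 3"
    if j: "j \<in> {1..n}" for j
  proof -
    define q where "q = exp (- (real j * s))"
    have q: "0 < q" "q < 1" using s j by (auto simp: q_def)
    have m: "occ s j \<ge> 0" using occ_nonneg s j by simp
    have "occ s j * \<bar>real j * \<theta>\<bar> = (real j * occ s j) * \<bar>\<theta>\<bar>" by (simp add: abs_mult)
    also have "\<dots> \<le> (1 / s) * (s / 2)"
      using \<theta> mult_occ_le_inverse[of s j] s j m by (intro mult_mono) auto
    finally have "occ s j * \<bar>real j * \<theta>\<bar> \<le> 1 / 2" using s by simp
    from geometric_char_approx[OF m this] obtain L where
      L: "1 / (1 - of_real (occ s j) * (cis (real j * \<theta>) - 1)) = exp L"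
       "norm (L - (\<i> * of_real (occ s j * (real j * \<theta>)) - of_real ((occ s j + occ s j ^ 2) * (real j * \<theta>)\<^sup>2 / 2)))
         \<le> 2 * (occ s j + occ s j ^ 2 + occ s j ^ 3) * \<bar>real j * \<theta>\<bar> ^ 3" by blast
    have occ: "occ s j = q / (1 - q)" by (simp add: occ_def q_def)
    have nz: "complex_of_real (1 - q) \<noteq> 0" using q by simp
    have "complex_of_real (1 - q) * (1 - of_real (occ s j) * (cis (real j * \<theta>) - 1)) = 1 - of_real q * cis (real j * \<theta>)"
      unfolding occ using nz by (simp add: field_simps)
    hence "of_real (1 - q) / (1 - of_real q * cis (real j * \<theta>)) = 1 / (1 - of_real (occ s j) * (cis (real j * \<theta>) - 1))"
      using nz by (metis mult.right_neutral mult_divide_mult_cancel_left)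
    with L show ?thesis unfolding q_def by metis
  qed
  then obtain L where L: "\<And>j. j \<in> {1..n} \<Longrightarrow> of_real (1 - exp (- (real j * s))) / (1 - of_real (exp (- (real j * s))) * cis (real j * \<theta>)) = exp (L j)"
      "\<And>j. j \<in> {1..n} \<Longrightarrow> norm (L j - (\<i> * of_real (occ s j * (real j * \<theta>)) - of_real ((occ s j + occ s j ^ 2) * (real j * \<theta>)\<^sup>2 / 2)))
         \<le> 2 * (occ s j + occ s j ^ 2 + occ s j ^ 3) * \<bar>real j * \<theta>\<bar> ^ 3"
    by metis
  define R where "R = (\<lambda>j. L j - (\<i> * of_real (occ s j * (real j * \<theta>)) - of_real ((occ s j + occ s j ^ 2) * (real j * \<theta>)\<^sup>2 / 2)))"
  define E where "E = (\<Sum>j=1..n. of_nat (a j) * R j)"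
  show thesis
  proof (rule that)
    have "tilt a n s \<theta> = (\<Prod>j=1..n. exp (L j) ^ a j)"
      unfolding tilt_def using L(1) by (intro prod.cong) auto
    also have "\<dots> = exp (\<Sum>j=1..n. of_nat (a j) * L j)"
      by (simp add: exp_sum exp_of_nat_mult)
    also have "(\<Sum>j=1..n. of_nat (a j) * L j) =
        (\<Sum>j=1..n. of_nat (a j) * R j + \<i> * of_real (real (a j) * (real j * occ s j) * \<theta>)
           + of_real (- (real (a j) * (real j)\<^sup>2 * (occ s j + occ s j ^ 2)) * \<theta>\<^sup>2 / 2))"
    proof (intro sum.cong refl)
      fix j
      have "of_real (- (real (a j) * (real j)\<^sup>2 * (occ s j + occ s j ^ 2)) * \<theta>\<^sup>2 / 2)
          = of_nat (a j) * (- complex_of_real ((occ s j + occ s j ^ 2) * (real j * \<theta>)\<^sup>2 / 2))"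
        by (simp add: power_mult_distrib)
      moreover have "\<i> * of_real (real (a j) * (real j * occ s j) * \<theta>)
          = of_nat (a j) * (\<i> * complex_of_real (occ s j * (real j * \<theta>)))"
        by simp
      ultimately show "of_nat (a j) * L j = of_nat (a j) * R j + \<i> * of_real (real (a j) * (real j * occ s j) * \<theta>)
           + of_real (- (real (a j) * (real j)\<^sup>2 * (occ s j + occ s j ^ 2)) * \<theta>\<^sup>2 / 2)"
        unfolding R_def by (simp only: distrib_left[symmetric]) (simp del: of_real_mult of_real_add of_real_divide)
    qed
    also have "\<dots> = E + \<i> * of_real ((\<Sum>j=1..n. real (a j) * (real j * occ s j)) * \<theta>)
        + of_real (- (\<Sum>j=1..n. real (a j) * (real j)\<^sup>2 * (occ s j + occ s j ^ 2)) * \<theta>\<^sup>2 / 2)"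
      unfolding E_def sum.distrib of_real_sum[symmetric] sum_distrib_left[symmetric] sum_distrib_right[symmetric]
        sum_divide_distrib[symmetric] sum_negf[symmetric] by simp
    finally have "tilt a n s \<theta> * cis (- (\<Sum>j=1..n. real (a j) * (real j * occ s j)) * \<theta>)
       = exp (E + \<i> * of_real ((\<Sum>j=1..n. real (a j) * (real j * occ s j)) * \<theta>)
        + of_real (- (\<Sum>j=1..n. real (a j) * (real j)\<^sup>2 * (occ s j + occ s j ^ 2)) * \<theta>\<^sup>2 / 2))
         * exp (\<i> * of_real (- (\<Sum>j=1..n. real (a j) * (real j * occ s j)) * \<theta>))"
      by (simp only: cis_conv_exp)
    also have "\<dots> = exp (of_real (- (\<Sum>j=1..n. real (a j) * (real j)\<^sup>2 * (occ s j + occ s j ^ 2)) * \<theta>\<^sup>2 / 2) + E)"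
      unfolding exp_add[symmetric] by (rule arg_cong[of _ _ exp]) (simp del: of_real_sum)
    finally show "tilt a n s \<theta> * cis (- (\<Sum>j=1..n. real (a j) * (real j * occ s j)) * \<theta>)
       = exp (of_real (- tilt_var a n s * \<theta>\<^sup>2 / 2) + E)" unfolding tilt_var_def .
    have "norm E \<le> (\<Sum>j=1..n. real (a j) * (2 * (occ s j + occ s j ^ 2 + occ s j ^ 3) * \<bar>real j * \<theta>\<bar> ^ 3))"
      unfolding E_def R_def using L(2)
      by (intro sum_norm_le) (auto simp: norm_mult intro!: mult_left_mono)
    also have "\<dots> = 2 * (\<Sum>j=1..n. real (a j) * real j ^ 3 * (occ s j + occ s j ^ 2 + occ s j ^ 3)) * \<bar>\<theta>\<bar> ^ 3"
      unfolding sum_distrib_left sum_distrib_right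
      by (intro sum.cong refl) (simp add: abs_mult power_mult_distrib algebra_simps)
    finally show "norm E \<le> 2 * (\<Sum>j=1..n. real (a j) * real j ^ 3 * (occ s j + occ s j ^ 2 + occ s j ^ 3)) * \<bar>\<theta>\<bar> ^ 3" .
  qed
qed

section \<open>The coefficient as an integral of the tilted characteristic function\<close>

lemma saddle_sum_altdef: "saddle_sum a n s = (\<Sum>j=1..n. real (a j) * (real j * occ s j))"
  unfolding saddle_sum_def occ_def by (simp add: mult_ac)

lemma saddle_var_altdef:
  assumes "saddle_point a n > 0"
  shows "saddle_var a n = tilt_var a n (saddle_point a n)"
  unfolding saddle_var_def tilt_var_def
proof (intro sum.cong refl)
  fix j assume "j \<in> {1..n}"
  define q where "q = exp (- (real j * saddle_point a n))"
  have "q \<noteq> 1" using assms \<open>j \<in> {1..n}\<close> by (auto simp: q_def)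
  hence "q / (1 - q) + (q / (1 - q))\<^sup>2 = q / (1 - q)\<^sup>2"
    by (simp add: divide_simps power2_eq_square) (simp add: algebra_simps)
  thus "(real j)\<^sup>2 * real (a j) * exp (- (real j * saddle_point a n)) / (1 - exp (- (real j * saddle_point a n)))\<^sup>2
    = real (a j) * (real j)\<^sup>2 * (occ (saddle_point a n) j + occ (saddle_point a n) j ^ 2)"
    unfolding occ_def q_def[symmetric] by simp
qed

text \<open>On the circle each 1 / (1 - z^j) is its value at \<theta> = 0 times a geometric
  characteristic function. These values and the modulus of z^(-n) do not depend on \<theta>; they
  form the denominator.\<close>

lemma tilt_has_integral:
  assumes s: "s > 0"
  shows "((\<lambda>\<theta>. tilt a n s \<theta> * cis (- real n * \<theta>)) has_integral
    of_real (2 * pi * multiset_count a n /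
      (exp (real n * s) * (\<Prod>j=1..n. (1 - exp (- (real j * s))) powi (- int (a j)))))) {-pi..pi}"
proof -
  define q where "q = (\<lambda>j::nat. exp (- (real j * s)))"
  define P where "P = exp (real n * s) * (\<Prod>j=1..n. (1 - q j) powi (- int (a j)))"
  have q: "0 < q j" "q j < 1" if "j \<in> {1..n}" for j using s that by (auto simp: q_def)
  have P: "P > 0"
    unfolding P_def using q by (intro mult_pos_pos prod_pos zero_less_power_int) auto
  have pow: "(exp (-s) * cis \<theta>) ^ j = of_real (q j) * cis (real j * \<theta>)" for j :: nat and \<theta>
    by (simp add: power_mult_distrib Complex.DeMoivre q_def flip: of_real_power exp_of_nat_mult del: of_real_exp)
  have eq: "(\<Prod>j=1..n. inverse (1 - (exp (-s) * cis \<theta>) ^ j) ^ a j) / (exp (-s) * cis \<theta>) ^ n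
      = of_real P * (tilt a n s \<theta> * cis (- real n * \<theta>))" for \<theta>
  proof -
    have "(\<Prod>j=1..n. inverse (1 - (exp (-s) * cis \<theta>) ^ j) ^ a j)
       = (\<Prod>j=1..n. of_real ((1 - q j) powi (- int (a j))) *
            (of_real (1 - q j) / (1 - of_real (q j) * cis (real j * \<theta>))) ^ a j)"
    proof (intro prod.cong refl)
      fix j assume "j \<in> {1..n}"
      hence nz: "complex_of_real (1 - q j) \<noteq> 0" using q[of j] by simp
      have "complex_of_real ((1 - q j) powi (- int (a j))) = inverse (complex_of_real (1 - q j)) ^ a j"
        by (simp add: power_int_minus power_inverse)
      hence "of_real ((1 - q j) powi (- int (a j))) *
            (of_real (1 - q j) / (1 - of_real (q j) * cis (real j * \<theta>))) ^ a j
         = (inverse (complex_of_real (1 - q j)) * (of_real (1 - q j) / (1 - of_real (q j) * cis (real j * \<theta>)))) ^ a j"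
        by (simp only: power_mult_distrib)
      also have "inverse (complex_of_real (1 - q j)) * (of_real (1 - q j) / (1 - of_real (q j) * cis (real j * \<theta>)))
         = inverse (1 - of_real (q j) * cis (real j * \<theta>))"
        using nz by (simp add: divide_inverse flip: mult.assoc del: of_real_diff)
      finally show "inverse (1 - (exp (-s) * cis \<theta>) ^ j) ^ a j = of_real ((1 - q j) powi (- int (a j))) *
            (of_real (1 - q j) / (1 - of_real (q j) * cis (real j * \<theta>))) ^ a j"
        unfolding pow by simp
    qed
    also have "\<dots> = of_real (\<Prod>j=1..n. (1 - q j) powi (- int (a j))) * tilt a n s \<theta>"
      by (simp only: prod.distrib tilt_def q_def of_real_prod)
    finally have 1: "(\<Prod>j=1..n. inverse (1 - (exp (-s) * cis \<theta>) ^ j) ^ a j)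
       = of_real (\<Prod>j=1..n. (1 - q j) powi (- int (a j))) * tilt a n s \<theta>" .
    have "inverse (q n) = exp (real n * s)" by (simp add: q_def exp_minus)
    hence 2: "inverse ((exp (-s) * cis \<theta>) ^ n) = of_real (exp (real n * s)) * cis (- real n * \<theta>)"
      by (simp only: pow inverse_mult_distrib cis_inverse of_real_inverse[symmetric] mult_minus_left)
    define A where "A = (\<Prod>j=1..n. (1 - q j) powi (- int (a j)))"
    have "(of_real A * z) * (of_real (exp (real n * s)) * w) = of_real P * (z * w)" for z w :: complex
      unfolding P_def A_def[symmetric] by (simp only: of_real_mult) algebra
    thus ?thesis unfolding divide_inverse 1 2 A_def by blast
  qed
  have "0 < exp (-s)" "exp (-s) < 1" using s by auto
  from multiset_count_has_integral[OF this, where n = n and a = a]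
  have "((\<lambda>\<theta>. of_real P * (tilt a n s \<theta> * cis (- real n * \<theta>))) has_integral of_real (2 * pi * multiset_count a n)) {-pi..pi}"
    unfolding eq .
  from has_integral_mult_right[OF this, of "inverse (of_real P)"]
  have "((\<lambda>\<theta>. inverse (of_real P) * (of_real P * (tilt a n s \<theta> * cis (- real n * \<theta>)))) has_integral
      inverse (of_real P) * of_real (2 * pi * multiset_count a n)) {-pi..pi}" .
  moreover have "inverse (of_real P) * (of_real P * z) = z" for z :: complex using P by simp
  moreover have "inverse (of_real P) * of_real u = complex_of_real (u / P)" for u
    by (simp add: divide_inverse mult.commute)
  ultimately have "((\<lambda>\<theta>. tilt a n s \<theta> * cis (- real n * \<theta>)) has_integral
      of_real (2 * pi * multiset_count a n / P)) {-pi..pi}"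
    by (simp only:)
  thus ?thesis unfolding P_def q_def .
qed

text \<open>Substituting \<theta> = t/B and encoding the range by an indicator places the integrals
  for all n on the same line, as dominated convergence requires.\<close>

lemma tilt_scaled_integral:
  assumes s: "s > 0" and B: "B > 0"
  shows "(LINT t|lborel. indicator {-(pi * B)..pi * B} t *\<^sub>R (tilt a n s (t / B) * cis (- real n * (t / B))))
    = of_real (2 * pi * B * multiset_count a n /
      (exp (real n * s) * (\<Prod>j=1..n. (1 - exp (- (real j * s))) powi (- int (a j)))))"
proof -
  define f where "f = (\<lambda>\<theta>. tilt a n s \<theta> * cis (- real n * \<theta>))"
  have cont: "continuous_on S (\<lambda>t. f (t / B))" for S
    unfolding f_def by (intro continuous_intros continuous_on_compose2[OF continuous_on_tilt[OF s, of UNIV]]) (use B in auto)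
  have "((\<lambda>t. f ((1 / B) * t)) has_integral (1 / \<bar>1 / B\<bar>) *\<^sub>R of_real (2 * pi * multiset_count a n /
      (exp (real n * s) * (\<Prod>j=1..n. (1 - exp (- (real j * s))) powi (- int (a j))))))
      ((\<lambda>x. x / (1 / B)) ` {-pi..pi})"
    unfolding f_def using B by (intro has_integral_stretch_real tilt_has_integral[OF s]) auto
  also have "(\<lambda>x. x / (1 / B)) ` {-pi..pi} = {-(pi * B)..pi * B}"
  proof -
    have "(\<lambda>x. x / (1 / B)) = (*) B" by (auto simp: fun_eq_iff)
    thus ?thesis using image_mult_atLeastAtMost[OF B, of "-pi" pi] by (simp add: mult.commute)
  qed
  finally have 1: "((\<lambda>t. f (t / B)) has_integral of_real (2 * pi * B * multiset_count a n /
      (exp (real n * s) * (\<Prod>j=1..n. (1 - exp (- (real j * s))) powi (- int (a j)))))) {-(pi * B)..pi * B}"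
    using B by (simp add: scaleR_conv_of_real mult_ac)
  have "set_integrable lborel {-(pi * B)..pi * B} (\<lambda>t. f (t / B))"
    by (intro borel_integrable_atLeastAtMost' cont)
  from set_borel_integral_eq_integral(2)[OF this] integral_unique[OF 1]
  show ?thesis unfolding set_lebesgue_integral_def f_def by simp
qed

lemma integral_exp_neg_half_square:
  "(LINT t|lborel. complex_of_real (exp (- t\<^sup>2 / 2))) = of_real (sqrt (2 * pi))"
proof -
  have "has_bochner_integral lborel std_normal_density 1"
    using std_normal_moment_even[of 0] by simp
  from has_bochner_integral_mult_right[OF this, of "sqrt (2 * pi)"]
  have "has_bochner_integral lborel (\<lambda>t. exp (- t\<^sup>2 / 2)) (sqrt (2 * pi))"
    by (simp add: std_normal_density_def)
  hence "(LINT t|lborel. exp (- t\<^sup>2 / 2)) = sqrt (2 * pi)"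
    by (simp add: has_bochner_integral_iff)
  thus ?thesis by (simp only: integral_complex_of_real)
qed

subsection \<open>Weights of regular growth\<close>

locale multiset_growth =
  fixes a :: "nat \<Rightarrow> nat" and r y D1 D2 :: real
  assumes r: "r > 0" and y: "y \<ge> 1" and D1: "D1 > 0" and D2: "D2 > 0"
    and lower: "\<And>j. j \<ge> 1 \<Longrightarrow> D1 * real j powr (r - 1) * y ^ j \<le> real (a j)"
    and upper: "\<And>j. j \<ge> 1 \<Longrightarrow> real (a j) \<le> D2 * real j powr (r - 1) * y ^ j"
begin

lemma y_power_exp: "y ^ j * exp (- (real j * (d + ln y))) = exp (- (real j * d))"
  using y by (subst power_eq_exp_ln) (auto simp: algebra_simps simp flip: exp_add)

lemma weight_lower:
  assumes "j \<ge> 1"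
  shows "D1 * real j powr (r - 1) * exp (- (real j * d)) \<le> real (a j) * exp (- (real j * (d + ln y)))"
  using mult_right_mono[OF lower[OF assms], of "exp (- (real j * (d + ln y)))"]
  by (simp add: y_power_exp mult.assoc)

lemma weight_upper:
  assumes "j \<ge> 1"
  shows "real (a j) * exp (- (real j * (d + ln y))) \<le> D2 * real j powr (r - 1) * exp (- (real j * d))"
  using mult_right_mono[OF upper[OF assms], of "exp (- (real j * (d + ln y)))"]
  by (simp add: y_power_exp mult.assoc)

lemma moment_upper:
  obtains C where "C > 0" "\<And>n d k. 0 < d \<Longrightarrow> d \<le> 1 \<Longrightarrow> 1 \<le> k \<Longrightarrow> k \<le> K \<Longrightarrow>
    (\<Sum>j=1..n. real (a j) * (real j ^ K * occ (d + ln y) j ^ k)) \<le> C * d powr (- (r + real K))"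
proof -
  obtain C where C: "C > 0" "\<And>n d. 0 < d \<Longrightarrow> d \<le> 1 \<Longrightarrow>
    (\<Sum>j=1..n. real j powr (r - 1) * exp (- (real j * d)) * (1 / d + real j) ^ K) \<le> C * d powr (- (r + real K))"
    using sum_powr_exp_le[OF r, of K] by blast
  show thesis
  proof (rule that[of "D2 * C"])
    show "D2 * C > 0" using C D2 by simp
    fix n k d assume d: "0 < d" "d \<le> (1::real)" and k: "1 \<le> k" "k \<le> K"
    have "real (a j) * (real j ^ K * occ (d + ln y) j ^ k)
        \<le> D2 * (real j powr (r - 1) * exp (- (real j * d)) * (1 / d + real j) ^ K)" if "j \<in> {1..n}" for j
    proof -
      have "real (a j) * (real j ^ K * occ (d + ln y) j ^ k)
         \<le> real (a j) * (exp (- (real j * (d + ln y))) * (1 / d + real j) ^ K)"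
        using that d k y by (intro mult_left_mono power_occ_le) auto
      also have "\<dots> \<le> (D2 * real j powr (r - 1) * exp (- (real j * d))) * (1 / d + real j) ^ K"
        unfolding mult.assoc[symmetric] using that d by (intro mult_right_mono weight_upper) auto
      finally show ?thesis by (simp add: mult_ac)
    qed
    hence "(\<Sum>j=1..n. real (a j) * (real j ^ K * occ (d + ln y) j ^ k))
       \<le> D2 * (\<Sum>j=1..n. real j powr (r - 1) * exp (- (real j * d)) * (1 / d + real j) ^ K)"
      unfolding sum_distrib_left by (rule sum_mono)
    also have "\<dots> \<le> D2 * (C * d powr (- (r + real K)))"
      using C d D2 by (intro mult_left_mono) auto
    finally show "(\<Sum>j=1..n. real (a j) * (real j ^ K * occ (d + ln y) j ^ k)) \<le> D2 * C * d powr (- (r + real K))"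
      by simp
  qed
qed

text \<open>For 1 \<le> jd \<le> 6 the weight j^(r-1) is comparable to d^(1-r), and exp (-jd) is at
  least exp (-6). The minimum in the constant covers both signs of r - 1.\<close>

lemma block_lower:
  obtains c where "c > 0"
    "\<And>d j. 0 < d \<Longrightarrow> 1 \<le> real j * d \<Longrightarrow> real j * d \<le> 6 \<Longrightarrow>
       c * d powr (1 - r) \<le> real (a j) * exp (- (real j * (d + ln y)))"
proof (rule that[of "D1 * exp (-6) * min 1 (6 powr (r - 1))"])
  show "D1 * exp (-6) * min 1 (6 powr (r - 1)) > 0" using D1 by simp
  fix d :: real and j :: nat assume d: "0 < d" "1 \<le> real j * d" "real j * d \<le> 6"
  have j: "j \<ge> 1" using d by (cases j) auto
  have "min 1 (6 powr (r - 1)) \<le> (real j * d) powr (r - 1)"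
  proof (cases "r \<ge> 1")
    case True
    have "1 powr (r - 1) \<le> (real j * d) powr (r - 1)" using True d by (intro powr_mono2) auto
    thus ?thesis by simp
  next
    case False
    have "6 powr (r - 1) \<le> (real j * d) powr (r - 1)" using False d by (intro powr_mono2') auto
    thus ?thesis by simp
  qed
  hence "min 1 (6 powr (r - 1)) * d powr (1 - r) \<le> (real j * d) powr (r - 1) * d powr (1 - r)"
    by (intro mult_right_mono) auto
  also have "\<dots> = real j powr (r - 1)"
    using d j by (simp add: powr_mult flip: powr_add)
  finally have "D1 * exp (-6) * (min 1 (6 powr (r - 1)) * d powr (1 - r)) \<le> D1 * exp (- (real j * d)) * real j powr (r - 1)"
    using D1 d by (intro mult_mono mult_left_mono) auto
  also have "\<dots> \<le> real (a j) * exp (- (real j * (d + ln y)))"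
    using weight_lower[OF j, of d] by (simp add: mult_ac)
  finally show "D1 * exp (-6) * min 1 (6 powr (r - 1)) * d powr (1 - r) \<le> real (a j) * exp (- (real j * (d + ln y)))"
    by (simp add: mult_ac)
qed

text \<open>For d \<le> 1 rounding up gives N \<le> 2/d, so the block ends at 3N \<le> 6/d. This is
  the origin of the condition 6/d \<le> n: the block must lie below the truncation.\<close>

lemma block_bounds:
  assumes "0 < d" "d \<le> 1" "6 / d \<le> real n"
  defines "N \<equiv> nat \<lceil>1 / d\<rceil>"
  shows "N \<ge> 1" "1 / d \<le> real N" "{N..3*N} \<subseteq> {1..n}"
    "\<And>j. j \<in> {N..3*N} \<Longrightarrow> 1 \<le> real j * d \<and> real j * d \<le> 6"
proof -
  have "1 \<le> 1 / d" using assms by simp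
  moreover have N: "real N = of_int \<lceil>1 / d\<rceil>" using assms by (simp add: N_def)
  ultimately have N1: "1 / d \<le> real N" and N2: "real N \<le> 2 * (1 / d)" by linarith+
  show "1 / d \<le> real N" by fact
  with \<open>1 \<le> 1 / d\<close> show N3: "N \<ge> 1" by linarith
  have "real (3 * N) \<le> 6 / d" using N2 by simp
  hence "3 * N \<le> n" using assms by linarith
  with N3 show "{N..3*N} \<subseteq> {1..n}" by auto
  fix j assume j: "j \<in> {N..3*N}"
  have "1 / d \<le> real j" using N1 j by (meson atLeastAtMost_iff of_nat_le_iff order_trans)
  moreover have "real j \<le> real (3 * N)" using j by (simp only: atLeastAtMost_iff of_nat_le_iff)
  hence "real j \<le> 6 / d" using \<open>real (3 * N) \<le> 6 / d\<close> by linarith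
  ultimately show "1 \<le> real j * d \<and> real j * d \<le> 6" using assms(1) by (simp add: field_simps)
qed

text \<open>The block contains at least 1/d indices, and each contributes at least a multiple of
  d^(1-r) times j^2 \<ge> d^(-2).\<close>

lemma variance_lower:
  obtains c where "c > 0" "\<And>n d. 0 < d \<Longrightarrow> d \<le> 1 \<Longrightarrow> 6 / d \<le> real n \<Longrightarrow>
    c * d powr (- (r + 2)) \<le> tilt_var a n (d + ln y)"
proof -
  obtain c where c: "c > 0" "\<And>d j. 0 < d \<Longrightarrow> 1 \<le> real j * d \<Longrightarrow> real j * d \<le> 6 \<Longrightarrow>
       c * d powr (1 - r) \<le> real (a j) * exp (- (real j * (d + ln y)))"
    using block_lower by blast
  show thesis
  proof (rule that[OF c(1)])
    fix n d assume d: "0 < d" "d \<le> (1::real)" "6 / d \<le> real n"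
    define s where "s = d + ln y"
    have s: "s > 0" unfolding s_def using d y by (intro add_pos_nonneg) auto
    define N where "N = nat \<lceil>1 / d\<rceil>"
    note B = block_bounds[OF d, folded N_def]
    have le: "c * d powr (1 - r) * (1 / d)\<^sup>2 \<le> real (a j) * (real j)\<^sup>2 * (occ s j + occ s j ^ 2)"
      if j: "j \<in> {N..3*N}" for j
    proof -
      have j1: "j \<ge> 1" using j B(1) by simp
      have "1 / d \<le> real j" using B(4)[OF j] d by (simp add: field_simps)
      hence "(1 / d)\<^sup>2 \<le> (real j)\<^sup>2" using d by (intro power_mono) auto
      moreover have "c * d powr (1 - r) \<le> real (a j) * exp (- (real j * s))"
        unfolding s_def using B(4)[OF j] d by (intro c(2)) auto
      moreover have "exp (- (real j * s)) \<le> occ s j + occ s j ^ 2"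
        using occ_ge_exp[OF s j1] by (simp add: add_increasing2)
      hence "real (a j) * exp (- (real j * s)) \<le> real (a j) * (occ s j + occ s j ^ 2)"
        by (intro mult_left_mono) auto
      ultimately have "c * d powr (1 - r) * (1 / d)\<^sup>2 \<le> (real (a j) * (occ s j + occ s j ^ 2)) * (real j)\<^sup>2"
        using occ_nonneg[OF s j1] by (intro mult_mono[OF order_trans]) auto
      thus ?thesis by (simp add: mult_ac)
    qed
    have "c * d powr (- (r + 2)) = (1 / d) * (c * d powr (1 - r) * (1 / d)\<^sup>2)"
    proof -
      have "d powr (- (r + 2)) = d powr (-1) * d powr (1 - r) * d powr (- 2)"
      proof -
        have "- (r + 2) = (-1) + (1 - r) + (- 2)" by simp
        thus ?thesis by (simp only: powr_add)
      qed
      also have "d powr (-1) = 1 / d" using d by (simp add: powr_minus_divide)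
      also have "d powr (-2) = (1 / d)\<^sup>2" using d by (simp add: powr_minus_divide power_one_over)
      finally show ?thesis by simp
    qed
    also have "\<dots> \<le> real (card {N..3*N}) * (c * d powr (1 - r) * (1 / d)\<^sup>2)"
      using B(2) c(1) by (intro mult_right_mono) auto
    also have "\<dots> \<le> (\<Sum>j\<in>{N..3*N}. real (a j) * (real j)\<^sup>2 * (occ s j + occ s j ^ 2))"
      using le by (intro sum_bounded_below[of _ "c * d powr (1 - r) * (1 / d)\<^sup>2", simplified of_nat_mult]) auto
    also have "\<dots> \<le> (\<Sum>j=1..n. real (a j) * (real j)\<^sup>2 * (occ s j + occ s j ^ 2))"
      using B(3) occ_nonneg[OF s] by (intro sum_mono2) auto
    finally show "c * d powr (- (r + 2)) \<le> tilt_var a n (d + ln y)"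
      unfolding s_def tilt_var_def .
  qed
qed

lemma variance_upper:
  obtains C where "C > 0" "\<And>n d. 0 < d \<Longrightarrow> d \<le> 1 \<Longrightarrow>
    tilt_var a n (d + ln y) \<le> C * d powr (- (r + 2))"
proof -
  obtain C where C: "C > 0" "\<And>n d k. 0 < d \<Longrightarrow> d \<le> 1 \<Longrightarrow> 1 \<le> k \<Longrightarrow> k \<le> 2 \<Longrightarrow>
    (\<Sum>j=1..n. real (a j) * (real j ^ 2 * occ (d + ln y) j ^ k)) \<le> C * d powr (- (r + real 2))"
    using moment_upper[of 2] by blast
  show thesis
  proof (rule that[of "2 * C"])
    fix n d assume d: "0 < d" "d \<le> (1::real)"
    have "tilt_var a n (d + ln y)
      = (\<Sum>j=1..n. real (a j) * (real j ^ 2 * occ (d + ln y) j ^ 1)) + (\<Sum>j=1..n. real (a j) * (real j ^ 2 * occ (d + ln y) j ^ 2))"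
      unfolding sum.distrib[symmetric] tilt_var_def by (intro sum.cong refl) (simp add: algebra_simps)
    also have "\<dots> \<le> C * d powr (- (r + real 2)) + C * d powr (- (r + real 2))"
      using d by (intro add_mono C(2)) auto
    finally show "tilt_var a n (d + ln y) \<le> 2 * C * d powr (- (r + 2))"
      by simp
  qed (use C in auto)
qed

lemma third_moment_upper:
  obtains C where "C > 0" "\<And>n d. 0 < d \<Longrightarrow> d \<le> 1 \<Longrightarrow>
    (\<Sum>j=1..n. real (a j) * real j ^ 3 * (occ (d + ln y) j + occ (d + ln y) j ^ 2 + occ (d + ln y) j ^ 3)) \<le> C * d powr (- (r + 3))"
proof -
  obtain C where C: "C > 0" "\<And>n d k. 0 < d \<Longrightarrow> d \<le> 1 \<Longrightarrow> 1 \<le> k \<Longrightarrow> k \<le> 3 \<Longrightarrow>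
    (\<Sum>j=1..n. real (a j) * (real j ^ 3 * occ (d + ln y) j ^ k)) \<le> C * d powr (- (r + real 3))"
    using moment_upper[of 3] by blast
  show thesis
  proof (rule that[of "3 * C"])
    fix n d assume d: "0 < d" "d \<le> (1::real)"
    have "(\<Sum>j=1..n. real (a j) * real j ^ 3 * (occ (d + ln y) j + occ (d + ln y) j ^ 2 + occ (d + ln y) j ^ 3))
      = (\<Sum>j=1..n. real (a j) * (real j ^ 3 * occ (d + ln y) j ^ 1)) + (\<Sum>j=1..n. real (a j) * (real j ^ 3 * occ (d + ln y) j ^ 2))
        + (\<Sum>j=1..n. real (a j) * (real j ^ 3 * occ (d + ln y) j ^ 3))"
      unfolding sum.distrib[symmetric] by (intro sum.cong refl) (simp add: algebra_simps)
    also have "\<dots> \<le> C * d powr (- (r + real 3)) + C * d powr (- (r + real 3)) + C * d powr (- (r + real 3))"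
      using d by (intro add_mono C(2)) auto
    finally show "(\<Sum>j=1..n. real (a j) * real j ^ 3 * (occ (d + ln y) j + occ (d + ln y) j ^ 2 + occ (d + ln y) j ^ 3)) \<le> 3 * C * d powr (- (r + 3))"
      by simp
  qed (use C in auto)
qed

lemma tilt_upper:
  obtains c where "c > 0" "\<And>n d \<theta>. 0 < d \<Longrightarrow> d \<le> 1 \<Longrightarrow> 6 / d \<le> real n \<Longrightarrow> \<bar>\<theta>\<bar> \<le> pi \<Longrightarrow>
    norm (tilt a n (d + ln y) \<theta>) \<le> exp (- (c * d powr (-r) * min 1 ((\<theta> / d)\<^sup>2)))"
proof -
  obtain c where c: "c > 0" "\<And>d j. 0 < d \<Longrightarrow> 1 \<le> real j * d \<Longrightarrow> real j * d \<le> 6 \<Longrightarrow>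
       c * d powr (1 - r) \<le> real (a j) * exp (- (real j * (d + ln y)))"
    using block_lower by blast
  show thesis
  \<comment> \<open>60 = 12 * 5, with 12 from the cosine sum and 5 from the modulus of a geometric
    characteristic function.\<close>
  proof (rule that[of "c / 60"])
    show "c / 60 > 0" using c by simp
    fix n d \<theta> assume d: "0 < d" "d \<le> (1::real)" "6 / d \<le> real n" and \<theta>: "\<bar>\<theta>\<bar> \<le> pi"
    define s where "s = d + ln y"
    have s: "s > 0" unfolding s_def using d y by (intro add_pos_nonneg) auto
    define N where "N = nat \<lceil>1 / d\<rceil>"
    note B = block_bounds[OF d, folded N_def]
    have "d powr (-r) = d powr (1 - r) * (1 / d)"
      using d by (simp add: powr_diff powr_minus field_simps)
    hence "c / 60 * d powr (-r) * min 1 ((\<theta> / d)\<^sup>2) = c * d powr (1 - r) * ((1 / d) * min 1 (((1 / d) * \<theta>)\<^sup>2) / 12) / 5"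
      by simp
    also have "\<dots> \<le> c * d powr (1 - r) * (real N * min 1 ((real N * \<theta>)\<^sup>2) / 12) / 5"
    proof -
      have "((1 / d) * \<theta>)\<^sup>2 \<le> (real N * \<theta>)\<^sup>2"
        unfolding power_mult_distrib using B(2) d by (intro mult_right_mono power_mono) auto
      hence "min 1 (((1 / d) * \<theta>)\<^sup>2) \<le> min 1 ((real N * \<theta>)\<^sup>2)" by (intro min.mono) auto
      thus ?thesis using B(2) d c by (intro divide_right_mono mult_left_mono mult_mono) auto
    qed
    also have "\<dots> \<le> c * d powr (1 - r) * (\<Sum>j=N..3*N. 1 - cos (real j * \<theta>)) / 5"
      using c by (intro divide_right_mono mult_left_mono sum_one_minus_cos_ge B(1) \<theta>) auto
    also have "\<dots> \<le> (\<Sum>j=N..3*N. real (a j) * exp (- (real j * s)) * (1 - cos (real j * \<theta>))) / 5"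
      unfolding sum_distrib_left s_def using B(4) d
      by (intro divide_right_mono sum_mono mult_right_mono c(2)) auto
    finally have "exp (- (\<Sum>j=N..3*N. real (a j) * exp (- (real j * s)) * (1 - cos (real j * \<theta>))) / 5)
       \<le> exp (- (c / 60 * d powr (-r) * min 1 ((\<theta> / d)\<^sup>2)))" by simp
    with norm_tilt_le[OF s B(3), of a \<theta>]
    show "norm (tilt a n (d + ln y) \<theta>) \<le> exp (- (c / 60 * d powr (-r) * min 1 ((\<theta> / d)\<^sup>2)))"
      unfolding s_def by linarith
  qed
qed

text \<open>Since B^2 has order d^(-r-2), for \<theta> = t/B the quantity d^(-r) (\<theta>/d)^2 has
  order t^2. While \<bar>\<theta>\<bar> \<le> d this gives Gaussian decay in t, weakened to 1 / (1 +
  t^2). Beyond, the bound exp (-c d^(-r)) is constant in t, but t^2 \<le> pi^2 B^2 is only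
  polynomial in d^(-r).\<close>

lemma tilt_dominated:
  fixes V :: "nat \<Rightarrow> real \<Rightarrow> real"
  defines "V \<equiv> (\<lambda>n d. \<Sum>j=1..n. real (a j) * (real j)\<^sup>2 * (occ (d + ln y) j + occ (d + ln y) j ^ 2))"
  obtains K where "K > 0" "\<And>n d t. 0 < d \<Longrightarrow> d \<le> 1 \<Longrightarrow> 6 / d \<le> real n \<Longrightarrow> \<bar>t\<bar> \<le> pi * sqrt (tilt_var a n (d + ln y)) \<Longrightarrow>
    norm (tilt a n (d + ln y) (t / sqrt (tilt_var a n (d + ln y)))) \<le> K * inverse (1 + t\<^sup>2)"
proof -
  obtain c where c: "c > 0" "\<And>n d \<theta>. 0 < d \<Longrightarrow> d \<le> 1 \<Longrightarrow> 6 / d \<le> real n \<Longrightarrow> \<bar>\<theta>\<bar> \<le> pi \<Longrightarrow>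
    norm (tilt a n (d + ln y) \<theta>) \<le> exp (- (c * d powr (-r) * min 1 ((\<theta> / d)\<^sup>2)))"
    using tilt_upper by blast
  obtain C where C: "C > 0" "\<And>n d. 0 < d \<Longrightarrow> d \<le> 1 \<Longrightarrow> tilt_var a n (d + ln y) \<le> C * d powr (- (r + 2))"
    using variance_upper by blast
  obtain b where b: "b > 0" "\<And>n d. 0 < d \<Longrightarrow> d \<le> 1 \<Longrightarrow> 6 / d \<le> real n \<Longrightarrow> b * d powr (- (r + 2)) \<le> tilt_var a n (d + ln y)"
    using variance_lower by blast
  \<comment> \<open>Makes d^(-r-2), the order of B^2, the p-th power of u = d^(-r), so that its
    product with exp (-cu) is bounded.\<close>
  define p where "p = (r + 2) / r"
  have p: "p > 0" using r by (simp add: p_def)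
  define K1 where "K1 = max 1 (C / c)"
  define K2 where "K2 = (1 + pi\<^sup>2 * C) * exp (p * ln (p / c) - p)"
  show thesis
  proof (rule that[of "max K1 K2"])
    show "max K1 K2 > 0" by (simp add: K1_def)
    fix n d t assume d: "0 < d" "d \<le> (1::real)" "6 / d \<le> real n" and t: "\<bar>t\<bar> \<le> pi * sqrt (tilt_var a n (d + ln y))"
    let ?V = "tilt_var a n (d + ln y)"
    define D where "D = d powr (- (r + 2))"
    have "d powr (- (r + 2)) \<ge> 1 powr (- (r + 2))" using d r by (intro powr_mono2') auto
    hence Dpos: "D \<ge> 1" by (simp add: D_def)
    have VC: "?V \<le> C * D" and Vb: "b * D \<le> ?V" unfolding D_def using C b d by auto
    have "b * D > 0" using b Dpos by simp
    with Vb have V: "?V > 0" by linarith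
    define \<theta> where "\<theta> = t / sqrt (?V)"
    have \<theta>: "\<bar>\<theta>\<bar> \<le> pi" using t V by (simp add: \<theta>_def divide_le_eq)
    have Dp: "D = (d powr (-r)) powr p" using r by (simp add: D_def p_def powr_powr)
    have Dd: "D = d powr (-r) / d\<^sup>2" unfolding D_def using d by (simp add: powr_diff powr_minus powr_add field_simps)
    have N: "norm (tilt a n (d + ln y) \<theta>) \<le> exp (- (c * d powr (-r) * min 1 ((\<theta> / d)\<^sup>2)))"
      using c(2) d \<theta> by blast
    have "norm (tilt a n (d + ln y) \<theta>) * (1 + t\<^sup>2) \<le> max K1 K2"
    proof (cases "(\<theta> / d)\<^sup>2 \<le> 1")
      case True
      have "d powr (-r) * (\<theta> / d)\<^sup>2 = D * t\<^sup>2 / ?V"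
        using V by (simp add: Dd \<theta>_def power_divide power_mult_distrib)
      also have "\<dots> \<ge> D * t\<^sup>2 / (C * D)"
        using VC V Dpos by (intro divide_left_mono) (auto intro: mult_pos_pos C(1))
      finally have "t\<^sup>2 / C \<le> d powr (-r) * (\<theta> / d)\<^sup>2" using Dpos by simp
      hence "c * (t\<^sup>2 / C) \<le> c * (d powr (-r) * (\<theta> / d)\<^sup>2)" using c by (intro mult_left_mono) auto
      hence "norm (tilt a n (d + ln y) \<theta>) \<le> exp (- (c / C * t\<^sup>2))"
        using N True by (simp add: min_absorb2 mult.assoc) (smt (verit) exp_le_cancel_iff)
      also have "\<dots> \<le> inverse (1 + c / C * t\<^sup>2)"
        unfolding exp_minus using c C by (intro le_imp_inverse_le add_pos_nonneg) auto
      finally have "norm (tilt a n (d + ln y) \<theta>) * (1 + t\<^sup>2) \<le> inverse (1 + c / C * t\<^sup>2) * (1 + t\<^sup>2)"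
        by (intro mult_right_mono) auto
      also have "\<dots> \<le> K1"
      proof -
        have pos: "1 + c / C * t\<^sup>2 > 0" using c C by (intro add_pos_nonneg) auto
        have "1 * 1 + (C / c) * (c / C * t\<^sup>2) \<le> K1 * 1 + K1 * (c / C * t\<^sup>2)"
          unfolding K1_def using c C by (intro add_mono mult_right_mono) auto
        hence "1 + t\<^sup>2 \<le> K1 * (1 + c / C * t\<^sup>2)" using c C by (simp add: distrib_left)
        thus ?thesis using pos by (simp add: divide_le_eq inverse_eq_divide)
      qed
      finally show ?thesis by simp
    next
      case False
      hence "norm (tilt a n (d + ln y) \<theta>) \<le> exp (- (c * d powr (-r)))"
        using N by (simp add: min_absorb1)
      moreover have "1 + t\<^sup>2 \<le> (1 + pi\<^sup>2 * C) * D"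
      proof -
        have "t\<^sup>2 \<le> (pi * sqrt (?V))\<^sup>2" using t V by (metis abs_le_square_iff abs_of_nonneg abs_ge_zero order_trans)
        also have "\<dots> = pi\<^sup>2 * ?V" using V by (simp add: power_mult_distrib)
        also have "\<dots> \<le> pi\<^sup>2 * (C * D)" using VC by (intro mult_left_mono) auto
        finally show ?thesis using Dpos by (simp add: distrib_right)
      qed
      ultimately have "norm (tilt a n (d + ln y) \<theta>) * (1 + t\<^sup>2) \<le> exp (- (c * d powr (-r))) * ((1 + pi\<^sup>2 * C) * D)"
        by (intro mult_mono) auto
      also have "\<dots> = (1 + pi\<^sup>2 * C) * ((d powr (-r)) powr p * exp (- (c * d powr (-r))))"
        by (simp add: Dp)
      also have "\<dots> \<le> K2"
        unfolding K2_def using C c p d by (intro mult_left_mono powr_mult_exp_bounded) auto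
      finally show ?thesis by simp
    qed
    moreover have "1 + t\<^sup>2 > 0" by (intro add_pos_nonneg) auto
    ultimately show "norm (tilt a n (d + ln y) (t / sqrt (?V))) \<le> max K1 K2 * inverse (1 + t\<^sup>2)"
      unfolding \<theta>_def by (simp add: pos_le_divide_eq divide_inverse[symmetric])
  qed
qed

subsection \<open>The saddle point and the local limit theorem\<close>

definition gap :: "nat \<Rightarrow> real" where
  "gap n = saddle_point a n - ln y"

lemma saddle_point_solves:
  assumes "n \<ge> 1"
  shows "saddle_point a n > 0" "saddle_sum a n (saddle_point a n) = real n"
proof -
  \<comment> \<open>Positivity and integrality of \<open>a 1\<close> give
    \<open>a 1 \<ge> 1\<close>, on which existence of the saddle point rests.\<close>
  have "0 < D1 * real 1 powr (r - 1) * y ^ 1" using D1 y by simp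
  also have "\<dots> \<le> real (a 1)" by (rule lower) simp
  finally have "a 1 \<ge> 1" by simp
  from theI'[OF saddle_point_ex1[of n a, OF assms this]]
  show "saddle_point a n > 0" "saddle_sum a n (saddle_point a n) = real n"
    unfolding saddle_point_def[symmetric] by auto
qed

text \<open>Otherwise exp (-jd) would be at least exp (-6) for all j \<le> n, and the upper half of
  the indices alone would contribute order n^(r+1) to the saddle sum, whose value is only n.\<close>

lemma gap_lower: "\<forall>\<^sub>F n in sequentially. 6 / real n \<le> gap n"
proof -
  have "filterlim (\<lambda>n. D1 * exp (-6) * (real n / 2) powr r) at_top sequentially"
    using r D1 by real_asymp
  hence "\<forall>\<^sub>F n in sequentially. D1 * exp (-6) * (real n / 2) powr r > 2"
    by (rule filterlim_at_top_dense[THEN iffD1, rule_format])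
  thus ?thesis using eventually_gt_at_top[of 0]
  proof eventually_elim
    case (elim n)
    define s where "s = saddle_point a n"
    have n: "n \<ge> 1" using elim by simp
    have s: "s > 0" "saddle_sum a n s = real n" unfolding s_def using saddle_point_solves[OF n] by auto
    have sd: "s = gap n + ln y" by (simp add: gap_def s_def)
    show ?case
    proof (rule ccontr)
      assume "\<not> 6 / real n \<le> gap n"
      hence g: "real n * gap n \<le> 6" using n by (simp add: field_simps)
      define J where "J = {n div 2 + 1..n}"
      have J: "J \<subseteq> {1..n}" by (auto simp: J_def)
      have le: "D1 * exp (-6) * (real n / 2) powr r \<le> real (a j) * (real j * occ s j)" if j: "j \<in> J" for j
      proof -
        have j1: "j \<ge> 1" "j \<le> n" using j J by auto
        have "n \<le> 2 * j" using j by (auto simp: J_def)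
        hence "real n / 2 \<le> real j" by linarith
        hence "(real n / 2) powr r \<le> real j powr r" using r by (intro powr_mono2) auto
        also have "real j powr r = real j powr (r - 1) * real j"
          using j1 by (simp add: powr_diff)
        finally have 1: "(real n / 2) powr r \<le> real j powr (r - 1) * real j" .
        \<comment> \<open>The sign of the gap is still unknown at this point.\<close>
        have "real j * gap n \<le> 6"
        proof (cases "gap n \<ge> 0")
          case True
          have "real j * gap n \<le> real n * gap n" using True j1 by (intro mult_right_mono) auto
          with g show ?thesis by linarith
        next
          case False
          hence "real j * gap n \<le> 0" by (intro mult_nonneg_nonpos) auto
          thus ?thesis by linarith
        qed
        hence "exp (-6) \<le> exp (- (real j * gap n))" by simp
        hence "D1 * exp (-6) * (real n / 2) powr r \<le> D1 * exp (- (real j * gap n)) * (real j powr (r - 1) * real j)"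
          using D1 1 by (intro mult_mono) auto
        also have "\<dots> = (D1 * real j powr (r - 1) * exp (- (real j * gap n))) * real j" by simp
        also have "\<dots> \<le> (real (a j) * exp (- (real j * s))) * real j"
          unfolding sd using j1 by (intro mult_right_mono weight_lower) auto
        also have "\<dots> \<le> real (a j) * occ s j * real j"
          using occ_ge_exp[OF s(1) j1(1)] by (intro mult_right_mono mult_left_mono) auto
        finally show ?thesis by (simp add: mult_ac)
      qed
      have "real n / 2 \<le> real (card J)" unfolding J_def by simp
      hence "(real n / 2) * (D1 * exp (-6) * (real n / 2) powr r) \<le> real (card J) * (D1 * exp (-6) * (real n / 2) powr r)"
        using D1 by (intro mult_right_mono) auto
      also have "\<dots> \<le> (\<Sum>j\<in>J. real (a j) * (real j * occ s j))"
        by (intro sum_bounded_below le)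
      also have "\<dots> \<le> (\<Sum>j=1..n. real (a j) * (real j * occ s j))"
        using J occ_nonneg[OF s(1)] by (intro sum_mono2) auto
      also have "\<dots> = real n" using s(2) by (simp add: saddle_sum_altdef)
      finally have "D1 * exp (-6) * (real n / 2) powr r \<le> 2" using n by (simp add: field_simps)
      with elim show False by simp
    qed
  qed
qed

text \<open>For the upper bound, the saddle sum decreases in s: with a gap of at least e' it would
  be at most its value at e' + ln y, which is bounded independently of n, whereas it equals n.
  Capping e at 1 meets the range of the moment bound.\<close>

lemma gap_tendsto: "gap \<longlonglongrightarrow> 0"
proof (rule order_tendstoI)
  fix e :: real assume "e < 0"
  show "\<forall>\<^sub>F n in sequentially. e < gap n"
    using gap_lower
  proof eventually_elim
    case (elim n)
    have "0 \<le> 6 / real n" by simp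
    with elim \<open>e < 0\<close> show ?case by linarith
  qed
next
  fix e :: real assume "0 < e"
  define e' where "e' = min e 1"
  have e': "0 < e'" "e' \<le> 1" "e' \<le> e" using \<open>0 < e\<close> by (auto simp: e'_def)
  obtain C where C: "C > 0" "\<And>n d k. 0 < d \<Longrightarrow> d \<le> 1 \<Longrightarrow> 1 \<le> k \<Longrightarrow> k \<le> 1 \<Longrightarrow>
    (\<Sum>j=1..n. real (a j) * (real j ^ 1 * occ (d + ln y) j ^ k)) \<le> C * d powr (- (r + real 1))"
    using moment_upper[of 1] by blast
  have "filterlim (\<lambda>n. real n) at_top sequentially" by (rule filterlim_real_sequentially)
  hence "\<forall>\<^sub>F n in sequentially. real n > C * e' powr (- (r + real 1))"
    by (rule filterlim_at_top_dense[THEN iffD1, rule_format])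
  thus "\<forall>\<^sub>F n in sequentially. gap n < e" using eventually_gt_at_top[of 0]
  proof eventually_elim
    case (elim n)
    have n: "n \<ge> 1" using elim by simp
    show ?case
    proof (rule ccontr)
      assume "\<not> gap n < e"
      hence "e' + ln y \<le> saddle_point a n" using e' by (simp add: gap_def)
      moreover have "e' + ln y > 0" using e' y by (intro add_pos_nonneg) auto
      ultimately have "saddle_sum a n (saddle_point a n) \<le> saddle_sum a n (e' + ln y)"
        unfolding saddle_sum_altdef by (intro sum_mono mult_left_mono occ_antimono) auto
      also have "\<dots> \<le> C * e' powr (- (r + real 1))"
        unfolding saddle_sum_altdef using C(2)[of e' 1 n] e' by simp
      finally show False using elim saddle_point_solves[OF n] by simp
    qed
  qed
qed

lemma eventually_gap_bounds: "\<forall>\<^sub>F n in sequentially. n \<ge> 1 \<and> 0 < gap n \<and> gap n \<le> 1 \<and> 6 / gap n \<le> real n"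
proof -
  have "\<forall>\<^sub>F n in sequentially. gap n < 1" using gap_tendsto by (rule order_tendstoD) simp
  with gap_lower show ?thesis using eventually_ge_at_top[of 1]
  proof eventually_elim
    case (elim n)
    have n: "0 < real n" using elim by simp
    hence "0 < 6 / real n" by simp
    hence g: "0 < gap n" using elim by linarith
    moreover have "6 / gap n \<le> real n" using elim n g by (simp add: field_simps)
    ultimately show ?case using elim by simp
  qed
qed

lemma saddle_point_eq_gap: "saddle_point a n = gap n + ln y"
  by (simp add: gap_def)

text \<open>For fixed t the angle t/B_n is O(d^(r/2+1)), which is o(d), so it eventually enters the
  range of \<open>tilt_approx\<close>.\<close>

lemma tilt_pointwise_limit:
  "(\<lambda>n. tilt a n (saddle_point a n) (t / sqrt (saddle_var a n)) * cis (- real n * (t / sqrt (saddle_var a n))))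
     \<longlonglongrightarrow> of_real (exp (- t\<^sup>2 / 2))"
proof -
  define s where "s = saddle_point a"
  define B where "B = (\<lambda>n. sqrt (saddle_var a n))"
  define F where "F = (\<lambda>n. tilt a n (s n) (t / B n) * cis (- real n * (t / B n)))"
  obtain C where C: "C > 0" "\<And>n d. 0 < d \<Longrightarrow> d \<le> 1 \<Longrightarrow>
    (\<Sum>j=1..n. real (a j) * real j ^ 3 * (occ (d + ln y) j + occ (d + ln y) j ^ 2 + occ (d + ln y) j ^ 3)) \<le> C * d powr (- (r + 3))"
    using third_moment_upper by blast
  obtain b where b: "b > 0" "\<And>n d. 0 < d \<Longrightarrow> d \<le> 1 \<Longrightarrow> 6 / d \<le> real n \<Longrightarrow> b * d powr (- (r + 2)) \<le> tilt_var a n (d + ln y)"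
    using variance_lower by blast
  define e where "e = (\<lambda>n. 2 * C * (\<bar>t\<bar> / sqrt b) ^ 3 * gap n powr (r / 2))"
  have pow0: "(\<lambda>n. gap n powr (r / 2)) \<longlonglongrightarrow> 0"
    using gap_tendsto r eventually_gap_bounds
    by (intro tendsto_zero_powrI[of _ _ _ "r/2"]) (auto elim: eventually_mono)
  have "(\<lambda>n. \<bar>t\<bar> / sqrt b * gap n powr (r / 2)) \<longlonglongrightarrow> \<bar>t\<bar> / sqrt b * 0"
    by (intro tendsto_intros pow0)
  hence "\<forall>\<^sub>F n in sequentially. \<bar>t\<bar> / sqrt b * gap n powr (r / 2) < 1 / 2"
    by (rule order_tendstoD) simp
  with eventually_gap_bounds have "\<forall>\<^sub>F n in sequentially. \<exists>E. F n = exp (of_real (- t\<^sup>2 / 2) + E) \<and> norm E \<le> e n"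
  proof eventually_elim
    case (elim n)
    define d where "d = gap n"
    have d: "0 < d" "d \<le> 1" "6 / d \<le> real n" "n \<ge> 1" using elim by (auto simp: d_def)
    have sd: "s n = d + ln y" by (simp add: s_def saddle_point_eq_gap d_def)
    have sp: "s n > 0" and sat: "saddle_sum a n (s n) = real n"
      using saddle_point_solves[OF d(4)] by (auto simp: s_def)
    have ds: "d \<le> s n" using y by (simp add: sd)
    have var: "saddle_var a n = tilt_var a n (s n)"
      using saddle_var_altdef[of a n] sp by (simp add: s_def)
    have Vb: "b * d powr (- (r + 2)) \<le> tilt_var a n (s n)" unfolding sd using b d by blast
    have Dp: "b * d powr (- (r + 2)) > 0" using b d by simp
    have V: "tilt_var a n (s n) > 0" using Vb Dp by linarith
    have B0: "B n > 0" using V by (simp add: B_def var)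
    have "sqrt (b * d powr (- (r + 2))) \<le> B n" using Vb by (simp add: B_def var)
    moreover have "sqrt (b * d powr (- (r + 2))) = sqrt b * d powr (- (r / 2 + 1))"
    proof -
      have "- (r / 2 + 1) = - (r + 2) / 2" by (simp add: field_simps)
      thus ?thesis using d by (simp only: real_sqrt_mult powr_half_sqrt_powr)
    qed
    ultimately have "\<bar>t\<bar> / B n \<le> \<bar>t\<bar> / (sqrt b * d powr (- (r / 2 + 1)))"
      using b d by (intro divide_left_mono) (auto intro!: mult_pos_pos B0)
    also have "\<dots> = \<bar>t\<bar> / sqrt b * d powr (r / 2 + 1)"
    proof -
      have "u / (v * inverse w) = u / v * w" for u v w :: real
        by (simp add: divide_inverse mult_ac)
      thus ?thesis by (simp only: powr_minus)
    qed
    finally have T: "\<bar>t / B n\<bar> \<le> \<bar>t\<bar> / sqrt b * d powr (r / 2 + 1)" using B0 by simp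
    also have "\<dots> = (\<bar>t\<bar> / sqrt b * d powr (r / 2)) * d"
      using d by (simp add: powr_add)
    also have "\<dots> \<le> (1 / 2) * d" using elim d by (intro mult_right_mono) (auto simp: d_def)
    also have "\<dots> \<le> s n / 2" using ds by simp
    finally have th: "\<bar>t / B n\<bar> \<le> s n / 2" .
    obtain E where E: 
    "tilt a n (s n) (t / B n) * cis (- (\<Sum>j=1..n. real (a j) * (real j * occ (s n) j)) * (t / B n))
       = exp (of_real (- tilt_var a n (s n) * (t / B n)\<^sup>2 / 2) + E)"
    "norm E \<le> 2 * (\<Sum>j=1..n. real (a j) * real j ^ 3 * (occ (s n) j + occ (s n) j ^ 2 + occ (s n) j ^ 3)) * \<bar>t / B n\<bar> ^ 3"
      using tilt_approx[OF sp th] by blast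
    have "F n = exp (of_real (- tilt_var a n (s n) * (t / B n)\<^sup>2 / 2) + E)"
      unfolding F_def using E(1) sat by (simp add: saddle_sum_altdef)
    also have "- tilt_var a n (s n) * (t / B n)\<^sup>2 / 2 = - t\<^sup>2 / 2"
      using V by (simp add: B_def var power_divide)
    finally have "F n = exp (of_real (- t\<^sup>2 / 2) + E)" .
    moreover have "norm E \<le> e n"
    proof -
      note E(2)
      also have "2 * (\<Sum>j=1..n. real (a j) * real j ^ 3 * (occ (s n) j + occ (s n) j ^ 2 + occ (s n) j ^ 3)) * \<bar>t / B n\<bar> ^ 3
        \<le> 2 * (C * d powr (- (r + 3))) * (\<bar>t\<bar> / sqrt b * d powr (r / 2 + 1)) ^ 3"
        unfolding sd using C d T by (intro mult_mono mult_left_mono power_mono) (auto simp: sd)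
      also have "\<dots> = 2 * C * (\<bar>t\<bar> / sqrt b) ^ 3 * (d powr (- (r + 3)) * (d powr (r / 2 + 1)) ^ 3)"
        by (simp only: power_mult_distrib mult_ac)
      also have "(d powr (r / 2 + 1)) ^ 3 = d powr (3 * (r / 2 + 1))"
        using d by (simp add: powr_powr[symmetric] powr_realpow[symmetric] powr_powr mult.commute)
      also have "d powr (- (r + 3)) * d powr (3 * (r / 2 + 1)) = d powr (r / 2)"
        by (simp flip: powr_add add: field_simps)
      finally show ?thesis by (simp add: e_def d_def)
    qed
    ultimately show ?case by blast
  qed
  \<comment> \<open>The error term exists for each large n separately; choice turns it into a
    sequence, with irrelevant values at the remaining n.\<close>
  moreover define E where "E = (\<lambda>n. SOME E. F n = exp (of_real (- t\<^sup>2 / 2) + E) \<and> norm E \<le> e n)"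
  ultimately have E: "\<forall>\<^sub>F n in sequentially. F n = exp (of_real (- t\<^sup>2 / 2) + E n) \<and> norm (E n) \<le> e n"
    by (auto elim!: eventually_mono intro: someI2_ex)
  have "e \<longlonglongrightarrow> 2 * C * (\<bar>t\<bar> / sqrt b) ^ 3 * 0"
    unfolding e_def by (intro tendsto_intros pow0)
  hence "E \<longlonglongrightarrow> 0" using E by (intro Lim_null_comparison[of E e]) (auto elim: eventually_mono)
  hence "(\<lambda>n. exp (of_real (- t\<^sup>2 / 2) + E n)) \<longlonglongrightarrow> exp (of_real (- t\<^sup>2 / 2) + 0)"
    by (intro tendsto_intros)
  moreover have "\<forall>\<^sub>F n in sequentially. exp (of_real (- t\<^sup>2 / 2) + E n) = F n"
    using E by (auto elim: eventually_mono)
  ultimately have "F \<longlonglongrightarrow> exp (of_real (- t\<^sup>2 / 2) + 0)"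
    by (rule Lim_transform_eventually)
  thus ?thesis by (simp add: F_def B_def s_def exp_of_real[symmetric])
qed

lemma scaled_integral_tendsto:
  "(\<lambda>n. 2 * pi * sqrt (saddle_var a n) * multiset_count a n /
      (exp (real n * saddle_point a n) * (\<Prod>j=1..n. (1 - exp (- (real j * saddle_point a n))) powi (- int (a j)))))
    \<longlonglongrightarrow> sqrt (2 * pi)"
proof -
  define B where "B = (\<lambda>n. sqrt (saddle_var a n))"
  define I where "I = (\<lambda>n. 2 * pi * B n * multiset_count a n /
      (exp (real n * saddle_point a n) * (\<Prod>j=1..n. (1 - exp (- (real j * saddle_point a n))) powi (- int (a j)))))"
  define G where "G = (\<lambda>n t. indicator {-(pi * B n)..pi * B n} t *\<^sub>R
      (tilt a n (saddle_point a n) (t / B n) * cis (- real n * (t / B n))))"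
  obtain K where K: "K > 0" "\<And>n d t. 0 < d \<Longrightarrow> d \<le> 1 \<Longrightarrow> 6 / d \<le> real n \<Longrightarrow> \<bar>t\<bar> \<le> pi * sqrt (tilt_var a n (d + ln y)) \<Longrightarrow>
    norm (tilt a n (d + ln y) (t / sqrt (tilt_var a n (d + ln y)))) \<le> K * inverse (1 + t\<^sup>2)"
    using tilt_dominated by blast
  obtain b where b: "b > 0" "\<And>n d. 0 < d \<Longrightarrow> d \<le> 1 \<Longrightarrow> 6 / d \<le> real n \<Longrightarrow> b * d powr (- (r + 2)) \<le> tilt_var a n (d + ln y)"
    using variance_lower by blast
  \<comment> \<open>Dominated convergence asks for the bound at every member of the sequence, so it
    is applied after a shift by \<open>n0\<close>, beyond which the gap is in range.\<close>
  obtain n0 where n0: "\<And>n. n \<ge> n0 \<Longrightarrow> n \<ge> 1 \<and> 0 < gap n \<and> gap n \<le> 1 \<and> 6 / gap n \<le> real n"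
    using eventually_gap_bounds unfolding eventually_sequentially by blast
  have good: "saddle_point a n > 0" "saddle_var a n = tilt_var a n (gap n + ln y)"
      "b * gap n powr (- (r + 2)) \<le> saddle_var a n" "B n > 0" if "n \<ge> n0" for n
  proof -
    show sp: "saddle_point a n > 0" using saddle_point_solves n0[OF that] by blast
    show v: "saddle_var a n = tilt_var a n (gap n + ln y)"
      using saddle_var_altdef[OF sp] by (simp add: saddle_point_eq_gap)
    show v2: "b * gap n powr (- (r + 2)) \<le> saddle_var a n"
      unfolding v using n0[OF that] by (intro b(2)) auto
    have "0 < b * gap n powr (- (r + 2))" using b n0[OF that] by simp
    with v2 have "saddle_var a n > 0" by linarith
    thus "B n > 0" by (simp add: B_def)
  qed
  \<comment> \<open>Hence the scaled intervals exhaust the line, and the indicator is eventually 1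
    at each t.\<close>
  have B_top: "filterlim B at_top sequentially"
  proof (rule filterlim_at_top_mono)
    have "filterlim gap (at_right 0) sequentially"
      using gap_tendsto eventually_gap_bounds by (auto simp: filterlim_at elim: eventually_mono)
    moreover have "filterlim (\<lambda>d. sqrt (b * d powr (- (r + 2)))) at_top (at_right 0)"
      using b r by real_asymp
    ultimately show "filterlim (\<lambda>n. sqrt (b * gap n powr (- (r + 2)))) at_top sequentially"
      by (rule filterlim_compose[rotated])
    show "\<forall>\<^sub>F n in sequentially. sqrt (b * gap n powr (- (r + 2))) \<le> B n"
      using eventually_ge_at_top[of n0] by eventually_elim (use good in \<open>simp add: B_def\<close>)
  qed
  have "(\<lambda>i. LINT t|lborel. G (i + n0) t) \<longlonglongrightarrow> (LINT t|lborel. complex_of_real (exp (- t\<^sup>2 / 2)))"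
  proof (rule integral_dominated_convergence)
    show "(\<lambda>t. complex_of_real (exp (- t\<^sup>2 / 2))) \<in> borel_measurable lborel" by measurable
    show "integrable lborel (\<lambda>t. K * inverse (1 + t\<^sup>2))"
      using integrable_inverse_1_plus_square by (simp add: set_integrable_def einterval_def)
    show "G (i + n0) \<in> borel_measurable lborel" for i
    proof -
      have "continuous_on UNIV (tilt a (i + n0) (saddle_point a (i + n0)))"
        using good(1)[of "i + n0"] by (intro continuous_on_tilt) auto
      note tilt = continuous_on_compose2[OF this]
      define h where "h = (\<lambda>t. tilt a (i + n0) (saddle_point a (i + n0)) (t / B (i + n0)) * cis (- real (i + n0) * (t / B (i + n0))))"
      have "B (i + n0) \<noteq> 0" using good(4)[of "i + n0"] by simp
      hence "continuous_on UNIV h"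
        unfolding h_def by (intro continuous_on_mult tilt continuous_intros) auto
      hence "h \<in> borel_measurable borel"
        by (rule borel_measurable_continuous_onI)
      hence "(\<lambda>t. indicator {-(pi * B (i + n0))..pi * B (i + n0)} t *\<^sub>R h t) \<in> borel_measurable borel"
        by (intro borel_measurable_scaleR borel_measurable_indicator) auto
      thus ?thesis unfolding G_def h_def by (simp only: measurable_lborel2)
    qed
    show "AE t in lborel. norm (G (i + n0) t) \<le> K * inverse (1 + t\<^sup>2)" for i
    proof (rule AE_I2)
      fix t :: real
      define n where "n = i + n0"
      have n: "n \<ge> n0" by (simp add: n_def)
      show "norm (G (i + n0) t) \<le> K * inverse (1 + t\<^sup>2)"
      proof (cases "t \<in> {-(pi * B n)..pi * B n}")
        case True
        hence "\<bar>t\<bar> \<le> pi * sqrt (tilt_var a n (gap n + ln y))" using good(2)[OF n] by (auto simp: B_def)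
        hence "norm (tilt a n (gap n + ln y) (t / sqrt (tilt_var a n (gap n + ln y)))) \<le> K * inverse (1 + t\<^sup>2)"
          using n0[OF n] by (intro K(2)) auto
        with True show ?thesis unfolding n_def[symmetric]
          by (simp add: G_def norm_mult B_def good(2)[OF n] saddle_point_eq_gap)
      next
        case False
        have "0 \<le> K * inverse (1 + t\<^sup>2)" using K by (intro mult_nonneg_nonneg) auto
        with False show ?thesis unfolding n_def[symmetric] by (simp add: G_def)
      qed
    qed
    show "AE t in lborel. (\<lambda>i. G (i + n0) t) \<longlonglongrightarrow> complex_of_real (exp (- t\<^sup>2 / 2))"
    proof (intro AE_I2 LIMSEQ_ignore_initial_segment)
      fix t :: real
      have "\<forall>\<^sub>F n in sequentially. B n > \<bar>t\<bar>"
        using B_top by (rule filterlim_at_top_dense[THEN iffD1, rule_format])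
      hence "\<forall>\<^sub>F n in sequentially. tilt a n (saddle_point a n) (t / B n) * cis (- real n * (t / B n)) = G n t"
      proof eventually_elim
        case (elim n)
        have "1 * B n \<le> pi * B n" using elim pi_gt3 by (intro mult_right_mono) auto
        with elim have "t \<in> {-(pi * B n)..pi * B n}" by auto
        thus ?case by (simp add: G_def)
      qed
      with tilt_pointwise_limit[of t] show "(\<lambda>n. G n t) \<longlonglongrightarrow> complex_of_real (exp (- t\<^sup>2 / 2))"
        unfolding B_def by (rule Lim_transform_eventually)
    qed
  qed
  moreover have "(LINT t|lborel. G (i + n0) t) = complex_of_real (I (i + n0))" for i
    unfolding G_def I_def using good[of "i + n0"] by (intro tilt_scaled_integral) auto
  ultimately have "(\<lambda>i. complex_of_real (I (i + n0))) \<longlonglongrightarrow> of_real (sqrt (2 * pi))"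
    by (simp only: integral_exp_neg_half_square)
  hence "(\<lambda>i. I (i + n0)) \<longlonglongrightarrow> sqrt (2 * pi)"
    by (simp only: tendsto_of_real_iff)
  thus ?thesis
    unfolding I_def B_def by (rule LIMSEQ_offset)
qed

end

theorem theorem1:
  fixes a :: "nat \<Rightarrow> nat" and r y D1 D2 :: real
  assumes "r > 0" and "y \<ge> 1" and "D1 > 0" and "D2 > 0"
    and "\<And>j. j \<ge> 1 \<Longrightarrow> D1 * real j powr (r - 1) * y ^ j \<le> real (a j)"
    and "\<And>j. j \<ge> 1 \<Longrightarrow> real (a j) \<le> D2 * real j powr (r - 1) * y ^ j"
  shows "multiset_count a \<sim>[at_top]
    (\<lambda>n. exp (real n * saddle_point a n) / sqrt (2 * pi * saddle_var a n)
       * (\<Prod>j=1..n. (1 - exp (- (real j * saddle_point a n))) powi (- int (a j))))"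
proof -
  interpret multiset_growth a r y D1 D2
    using assms by unfold_locales auto
  define P where "P = (\<lambda>n. exp (real n * saddle_point a n) * (\<Prod>j=1..n. (1 - exp (- (real j * saddle_point a n))) powi (- int (a j))))"
  define f where "f = (\<lambda>n. 2 * pi * sqrt (saddle_var a n) * multiset_count a n / P n / sqrt (2 * pi))"
  have "f \<longlonglongrightarrow> sqrt (2 * pi) / sqrt (2 * pi)"
    unfolding f_def P_def by (intro tendsto_divide scaled_integral_tendsto tendsto_const) auto
  hence "f \<longlonglongrightarrow> 1" by simp
  \<comment> \<open>The identity holds for every n: at n = 0 the variance is an empty sum, and both
    sides are 0 because x / 0 = 0.\<close>
  moreover have "f = (\<lambda>n. multiset_count a n / (exp (real n * saddle_point a n) / sqrt (2 * pi * saddle_var a n)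
       * (\<Prod>j=1..n. (1 - exp (- (real j * saddle_point a n))) powi (- int (a j)))))"
  proof
    fix n
    define w where "w = sqrt (2 * pi)"
    have w: "w > 0" "2 * pi = w * w" by (simp_all add: w_def)
    have "f n = w * sqrt (saddle_var a n) * multiset_count a n / P n"
      unfolding f_def w_def[symmetric] w(2) using w(1) by simp
    thus "f n = multiset_count a n / (exp (real n * saddle_point a n) / sqrt (2 * pi * saddle_var a n)
       * (\<Prod>j=1..n. (1 - exp (- (real j * saddle_point a n))) powi (- int (a j))))"
      by (simp add: P_def w_def real_sqrt_mult)
  qed
  ultimately show ?thesis
    by (intro asymp_equivI') (simp only:)
qed

end
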